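(* Let $G$ be a connected ribbon graph with edge set $[n]=\{1,\dots,n\}$, let $T\subseteq[n]$ be the edge set of any spanning quasi-tree of $G$, and let $\sigma$ be a signed rotation of the partial dual $G^{\delta(T)}$ (which is a bouquet). Let $\mathbf{A}^s_\sigma$ be the symbolic skew-adjacency matrix of $G^{\delta(T)}$ with respect to $\sigma$, let $f$ be the reduction map, and let $I_n$ be the $n\times n$ identity matrix. Then \[ f\bigl(\det(I_n+\mathbf{A}^s_\sigma)\bigr) \bmod 2=\sum_X x_X , \] where the sum is over all subsets $X\subseteq[n]$ such that the symmetric difference $X\,\Delta\,T$ is the edge set of a spanning quasi-tree of $G$. Consequently, the number $\tau(G)$ of spanning quasi-trees of $G$ is \[ \tau(G)=\Bigl(f\bigl(\det(I_n+\mathbf{A}^s_\sigma)\bigr) \bmod 2\Bigr)\Big|_{x_X=1}, \] i.e. the integer obtained by setting $x_X=1$ for all $X\subseteq[n]$ in the polynomial whose coefficients have been reduced modulo 2 to values in $\{0,1\}$.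
   Context: Ribbon graphs. A ribbon graph $G=(V(G),E(G))$ is a (possibly non-orientable) surface with boundary, represented as the union of a set $V(G)$ of topological discs (vertices) and a set $E(G)$ of topological discs (edges) such that: vertices and edges intersect in disjoint line segments; each such line segment lies on the boundary of precisely one vertex and precisely one edge; every edge contains exactly two such line segments. A bouquet is a ribbon graph with exactly one vertex, so each of its edges is a loop. A loop is non-orientable if its ribbon together with the vertex forms a Möbius band, and orientable otherwise. A ribbon graph is a quasi-tree if it has exactly one boundary component. For $X\subseteq E(G)$, $X$ is the edge set of a spanning quasi-tree of $G$ if the spanning ribbon subgraph $(V(G),X)$ (all vertices kept, edges outside $X$ deleted) is a quasi-tree. $\tau(G)$ is the number of spanning quasi-trees of a connected ribbon graph $G$. Partial dual. For a ribbon graph $G$ and $A\subseteq E(G)$, the partial dual $G^{\delta(A)}$ is the ribbon graph obtained from $G$ by gluing a disc to $G$ along each boundary component of the spanning ribbon subgraph $(V(G),A)$ (these discs are the vertex-discs of $G^{\delta(A)}$), removing the interiors of all vertex-discs of $G$, and keeping the edge-ribbons unchanged. Thus $G^{\delta(A)}$ has the same edge set as $G$; when $T$ is the edge set of a spanning quasi-tree of $G$, $G^{\delta(T)}$ has exactly one vertex, i.e. is a bouquet. Signed rotation. A signed rotation $\sigma$ of a bouquet $B$ with edge set $[n]$ is a cyclic sequence of length $2n$ encoding the order of the half-edges around the vertex. Each loop $i\in[n]$ appears twice, one occurrence labelled $i^a$ and the other $i^b$, and each occurrence carries a sign: $i^a$ and $i^b$ have identical signs if the loop $i$ is orientable, and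 opposite signs if it is non-orientable. (The starting point, the direction of traversal and the choice of which occurrence is labelled $a$ or $b$ are arbitrary.) Symbolic skew-adjacency matrix. For a bouquet with edge set $[n]$ and signed rotation $\sigma$, $\mathbf{A}^s_\sigma$ is the $n\times n$ matrix over the polynomial ring $\mathbb{Z}[x_{ij}: i,j\in[n]]$ in commuting indeterminates, with entries: diagonal entry $(i,i)$ equal to $x_{ii}$ if the signs of $i^a$ and $i^b$ in $\sigma$ are opposite, and $0$ if they are the same; for $i<j$, the $(i,j)$ entry is $x_{ij}$ if the relative cyclic order in $\sigma$ (ignoring signs) is $i^a,j^a,i^b,j^b$, it is $-x_{ij}$ if the relative cyclic order is $i^a,j^b,i^b,j^a$, and $0$ otherwise; for $i>j$, the $(i,j)$ entry is minus the $(j,i)$ entry. Reduction map. Let $\mathbb{Z}[x_A:A\subseteq[n]]$ denote the commutative ring of $\mathbb{Z}$-linear combinations of the symbols $x_A$ ($A\subseteq[n]$), with multiplication $x_A\cdot x_B=x_{A\cup B}$ and unit $x_\emptyset=1$. The reduction map $f:\mathbb{Z}[x_{ij}]\to\mathbb{Z}[x_A:A\subseteq[n]]$ is the $\mathbb{Z}$-linear map sending a monomial $m=\prod_{r=1}^k x_{i_rj_r}^{e_r}$ (with $e_r\ge1$) to $x_A$, where $A=\bigcup_{r=1}^k\{i_r,j_r\}$ (so $f(1)=x_\emptyset$). Reduction modulo 2. For $P\in\mathbb{Z}[x_A:A\subseteq[n]]$, $P\bmod 2$ is obtained by reducing each coefficient of $P$ (in the basis $x_A$) modulo 2, with values taken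 in $\{0,1\}$. *)

theory Defs
  imports "HOL-Library.Poly_Mapping" "Jordan_Normal_Form.Determinant"
begin

section \<open>Ribbon graphs\<close>

text \<open>
  A ribbon graph is given by its cell decomposition.  An edge disc meets the vertex discs in two
  disjoint line segments, so its boundary is a rectangle made of these two segments and two free
  sides; its four corners are the end points of the segments.  What remains of the boundary of a
  vertex disc after removing its segments is a union of arcs joining corners.  Hence each corner is
  an end point of exactly one segment, one free side and one vertex arc, and \<open>seg\<close>, \<open>side\<close>
  and \<open>varc\<close> send a corner to the other end point of that segment, side or arc.  The ribbon
  graph is determined by this incidence data up to homeomorphism.

  A vertex disc without segments carries no corner; such vertices are collected in
  \<open>isolated\<close>.
\<close>

record ('e, 'f, 'v) ribbon =
  corners :: "'f set"
  isolated :: "'v set"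
  edge_of :: "'f \<Rightarrow> 'e"
  seg :: "'f \<Rightarrow> 'f"
  side :: "'f \<Rightarrow> 'f"
  varc :: "'f \<Rightarrow> 'f"

definition pairing_on :: "'f set \<Rightarrow> ('f \<Rightarrow> 'f) \<Rightarrow> bool" where
  "pairing_on C s \<longleftrightarrow> (\<forall>c\<in>C. s c \<in> C \<and> s c \<noteq> c \<and> s (s c) = c)"

definition ribbon_graph :: "('e, 'f, 'v) ribbon \<Rightarrow> bool" where
  "ribbon_graph G \<longleftrightarrow>
     finite (corners G) \<and> finite (isolated G) \<and>
     pairing_on (corners G) (seg G) \<and>
     pairing_on (corners G) (side G) \<and>
     pairing_on (corners G) (varc G) \<and>
     (\<forall>c\<in>corners G.
        seg G c \<noteq> side G c \<and> seg G (side G c) = side G (seg G c) \<and>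
        {d \<in> corners G. edge_of G d = edge_of G c}
          = {c, seg G c, side G c, side G (seg G c)})"

definition edges :: "('e, 'f, 'v) ribbon \<Rightarrow> 'e set" where
  "edges G = edge_of G ` corners G"

text \<open>The closed curves traced by alternately following two pairings of the corners, each curve
  being represented by the set of corners on it.\<close>

definition curves :: "'f set \<Rightarrow> ('f \<Rightarrow> 'f) \<Rightarrow> ('f \<Rightarrow> 'f) \<Rightarrow> 'f set set" where
  "curves C s t = C // {(c, d). c \<in> C \<and> (d = s c \<or> d = t c)}\<^sup>*"

definition vertices :: "('e, 'f, 'v) ribbon \<Rightarrow> ('f set + 'v) set" where
  "vertices G = Inl ` curves (corners G) (varc G) (seg G) \<union> Inr ` isolated G"

text \<open>The boundary components of the spanning ribbon subgraph with edge set \<open>X\<close>.  Its boundary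
  consists of all vertex arcs, the free sides of the edges in \<open>X\<close>, and the segments at which the
  deleted edges (those outside \<open>X\<close>) were attached; an isolated vertex disc contributes its whole
  boundary circle.\<close>

definition boundary_components ::
    "('e, 'f, 'v) ribbon \<Rightarrow> 'e set \<Rightarrow> ('f set + 'v) set" where
  "boundary_components G X =
     Inl ` curves (corners G) (varc G) (\<lambda>c. if edge_of G c \<in> X then side G c else seg G c)
     \<union> Inr ` isolated G"

definition spanning_quasi_tree :: "('e, 'f, 'v) ribbon \<Rightarrow> 'e set \<Rightarrow> bool" where
  "spanning_quasi_tree G X \<longleftrightarrow> X \<subseteq> edges G \<and> card (boundary_components G X) = 1"

definition num_spanning_quasi_trees :: "('e, 'f, 'v) ribbon \<Rightarrow> nat" where
  "num_spanning_quasi_trees G = card {X. spanning_quasi_tree G X}"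

definition components :: "('e, 'f, 'v) ribbon \<Rightarrow> ('f set + 'v) set" where
  "components G =
     Inl ` (corners G //
       {(c, d). c \<in> corners G \<and> (d = seg G c \<or> d = side G c \<or> d = varc G c)}\<^sup>*)
     \<union> Inr ` isolated G"

definition connected_ribbon :: "('e, 'f, 'v) ribbon \<Rightarrow> bool" where
  "connected_ribbon G \<longleftrightarrow> card (components G) = 1"

definition bouquet :: "('e, 'f, 'v) ribbon \<Rightarrow> bool" where
  "bouquet G \<longleftrightarrow> ribbon_graph G \<and> card (vertices G) = 1"

text \<open>The spanning ribbon subgraph with edge set \<open>X\<close> is an orientable surface: an orientation of
  a disc marks each corner on its boundary as the beginning or the end of the segment there, and
  orientations of all discs fit together iff these marks can be chosen so that they alternate along
  vertex arcs, segments, and the free sides of the edges in \<open>X\<close>.\<close>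

definition orientable_spanning :: "('e, 'f, 'v) ribbon \<Rightarrow> 'e set \<Rightarrow> bool" where
  "orientable_spanning G X \<longleftrightarrow>
     (\<exists>m :: 'f \<Rightarrow> bool. \<forall>c\<in>corners G.
        m (varc G c) \<noteq> m c \<and> m (seg G c) \<noteq> m c \<and>
        (edge_of G c \<in> X \<longrightarrow> m (side G c) \<noteq> m c))"

text \<open>For a loop of a bouquet the spanning ribbon subgraph with this single edge is an annulus or a
  Moebius band, the latter being the non-orientable one.\<close>

definition orientable_loop :: "('e, 'f, 'v) ribbon \<Rightarrow> 'e \<Rightarrow> bool" where
  "orientable_loop B i \<longleftrightarrow> orientable_spanning B {i}"

text \<open>The new vertex discs are glued in along the boundary components of the spanning ribbon subgraph
  with edge set \<open>A\<close>.  After the old vertex discs are removed, an edge in \<open>A\<close> is therefore attached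
  along its former free sides while its former segments become free; arcs, corners, edge discs and
  the other edges' attachments are unchanged.\<close>

definition partial_dual :: "('e, 'f, 'v) ribbon \<Rightarrow> 'e set \<Rightarrow> ('e, 'f, 'v) ribbon" where
  "partial_dual G A = G\<lparr>
     seg := (\<lambda>c. if edge_of G c \<in> A then side G c else seg G c),
     side := (\<lambda>c. if edge_of G c \<in> A then seg G c else side G c)\<rparr>"

lemma edges_partial_dual: "edges (partial_dual G A) = edges G"
  by (simp add: edges_def partial_dual_def)

lemma vertices_partial_dual: "vertices (partial_dual G A) = boundary_components G A"
  by (simp add: vertices_def boundary_components_def partial_dual_def)

lemma ribbon_graph_partial_dual:
  assumes "ribbon_graph G"
  shows "ribbon_graph (partial_dual G A)"
proof -
  have same: "edge_of G (seg G c) = edge_of G c" "edge_of G (side G c) = edge_of G c"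
    if "c \<in> corners G" for c
    using assms that unfolding ribbon_graph_def by blast+
  show ?thesis
    using assms same unfolding ribbon_graph_def pairing_on_def partial_dual_def
    by (auto 0 3)
qed

lemma bouquet_partial_dual:
  assumes "ribbon_graph G" "spanning_quasi_tree G T"
  shows "bouquet (partial_dual G T)"
  using assms ribbon_graph_partial_dual[of G T]
  by (simp add: bouquet_def vertices_partial_dual spanning_quasi_tree_def)


section \<open>Signed rotations and the symbolic skew-adjacency matrix\<close>

datatype end_label = EndA | EndB
datatype half_sign = Pos | Neg

text \<open>A cyclic sequence is represented by any list obtained by cutting it open.  The entry
  \<open>(i, EndA, s)\<close> is the occurrence $i^a$ with sign \<open>s\<close>.\<close>

type_synonym 'e signed_seq = "('e \<times> end_label \<times> half_sign) list"

text \<open>The list \<open>cs\<close> records a traversal of the boundary circle of the vertex: the \<open>k\<close>-th half-edge is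
  entered at the corner \<open>cs ! k\<close>, and its segment is left at \<open>seg B (cs ! k)\<close>.\<close>

definition signed_rotation :: "('e, 'f, 'v) ribbon \<Rightarrow> 'e signed_seq \<Rightarrow> bool" where
  "signed_rotation B \<sigma> \<longleftrightarrow>
     bouquet B \<and>
     (\<exists>cs. length cs = length \<sigma> \<and> distinct cs \<and>
        set cs \<inter> seg B ` set cs = {} \<and> set cs \<union> seg B ` set cs = corners B \<and>
        (\<forall>k<length cs. cs ! (Suc k mod length cs) = varc B (seg B (cs ! k)) \<and>
           fst (\<sigma> ! k) = edge_of B (cs ! k))) \<and>
     distinct (map (\<lambda>(i, l, s). (i, l)) \<sigma>) \<and>
     set (map (\<lambda>(i, l, s). (i, l)) \<sigma>) = edges B \<times> {EndA, EndB} \<and>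
     (\<forall>i s s'. (i, EndA, s) \<in> set \<sigma> \<and> (i, EndB, s') \<in> set \<sigma> \<longrightarrow>
        (s = s' \<longleftrightarrow> orientable_loop B i))"

definition opposite_signs :: "'e signed_seq \<Rightarrow> 'e \<Rightarrow> bool" where
  "opposite_signs \<sigma> i \<longleftrightarrow>
     (\<exists>s s'. (i, EndA, s) \<in> set \<sigma> \<and> (i, EndB, s') \<in> set \<sigma> \<and> s \<noteq> s')"

text \<open>The occurrences of \<open>i\<close> and \<open>j\<close>, signs ignored, appear in the relative cyclic order
  \<open>w\<close>.\<close>

definition relative_order ::
    "'e signed_seq \<Rightarrow> 'e \<Rightarrow> 'e \<Rightarrow> ('e \<times> end_label) list \<Rightarrow> bool" where
  "relative_order \<sigma> i j w \<longleftrightarrow>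
     (\<exists>k. filter (\<lambda>(e, l). e = i \<or> e = j) (map (\<lambda>(e, l, s). (e, l)) \<sigma>) = rotate k w)"

text \<open>Polynomials with integer coefficients in indeterminates $x_{ij}$: a monomial is its
  finitely supported exponent function.\<close>

type_synonym xpoly = "((nat \<times> nat) \<Rightarrow>\<^sub>0 nat) \<Rightarrow>\<^sub>0 int"

definition xvar :: "nat \<Rightarrow> nat \<Rightarrow> xpoly" where
  "xvar i j = Poly_Mapping.single (Poly_Mapping.single (i, j) 1) 1"

definition upper_entry :: "nat signed_seq \<Rightarrow> nat \<Rightarrow> nat \<Rightarrow> xpoly" where
  "upper_entry \<sigma> i j =
     (if relative_order \<sigma> i j [(i, EndA), (j, EndA), (i, EndB), (j, EndB)] then xvar i j
      else if relative_order \<sigma> i j [(i, EndA), (j, EndB), (i, EndB), (j, EndA)] then - xvar i j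
      else 0)"

definition skew_entry :: "nat signed_seq \<Rightarrow> nat \<Rightarrow> nat \<Rightarrow> xpoly" where
  "skew_entry \<sigma> i j =
     (if i = j then (if opposite_signs \<sigma> i then xvar i i else 0)
      else if i < j then upper_entry \<sigma> i j
      else - upper_entry \<sigma> j i)"

text \<open>Edges are numbered from 1, matrix indices from 0.\<close>

definition skew_adjacency :: "nat \<Rightarrow> nat signed_seq \<Rightarrow> xpoly mat" where
  "skew_adjacency n \<sigma> = mat n n (\<lambda>(i, j). skew_entry \<sigma> (Suc i) (Suc j))"


section \<open>The reduction map\<close>

text \<open>The index sets form a monoid under union, so that finitely supported functions on them form
  the ring with basis $x_A$ and multiplication $x_A x_B = x_{A \cup B}$.\<close>

datatype 'a index_set = Index (elements: "'a set")

instantiation index_set :: (type) comm_monoid_add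
begin

definition zero_index_set :: "'a index_set" where
  "0 = Index {}"

definition plus_index_set :: "'a index_set \<Rightarrow> 'a index_set \<Rightarrow> 'a index_set" where
  "A + B = Index (elements A \<union> elements B)"

instance
  by standard (auto simp: zero_index_set_def plus_index_set_def)

end

type_synonym set_poly = "nat index_set \<Rightarrow>\<^sub>0 int"

definition xset :: "nat set \<Rightarrow> set_poly" where
  "xset A = Poly_Mapping.single (Index A) 1"

lemma xset_mult: "xset A * xset B = xset (A \<union> B)"
  by (simp add: xset_def mult_single plus_index_set_def)

lemma xset_empty: "xset {} = 1"
  by (metis xset_def zero_index_set_def single_one)

definition reduction_map :: "xpoly \<Rightarrow> set_poly" where
  "reduction_map P =
     (\<Sum>m\<in>Poly_Mapping.keys P.
        of_int (Poly_Mapping.lookup P m) * xset (\<Union>(i, j)\<in>Poly_Mapping.keys m. {i, j}))"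

definition reduce_mod2 :: "set_poly \<Rightarrow> set_poly" where
  "reduce_mod2 P = Poly_Mapping.map (\<lambda>c. c mod 2) P"

definition eval_ones :: "set_poly \<Rightarrow> int" where
  "eval_ones P = (\<Sum>A\<in>Poly_Mapping.keys P. Poly_Mapping.lookup P A)"

end

theory Submission
  imports Defs "HOL-Library.Z2"
begin

text \<open>
  Write \<open>B\<close> for the bouquet obtained as the partial dual of \<open>G\<close> with respect to \<open>T\<close>.  Exchanging
  segments and free sides of the edges in \<open>T\<close> turns the boundary of the spanning subgraph of \<open>B\<close>
  with edge set \<open>X\<close> into that of the spanning subgraph of \<open>G\<close> with edge set \<open>X \<Delta> T\<close>
  (\<open>boundary_components_partial_dual\<close>).  So the task is to recognise the sets \<open>X\<close> of loops of a
  bouquet for which the disc with the ribbons \<open>X\<close> attached has a single boundary component.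

  On the algebraic side, the reduction map is a ring homomorphism, because the indeterminates
  occurring in a product of monomials are those of the factors together.  In the Leibniz formula for
  the determinant of \<open>I + A\<close>, taking the entries of \<open>A\<close> in the rows of \<open>S\<close> and those of \<open>I\<close> in the
  others leaves only the permutations of \<open>S\<close>, and the indices of the entries used then fill \<open>S\<close>.  Hence
  the reduced determinant is the sum over all \<open>S\<close> of \<open>x\<^sub>S\<close> times the principal minor on \<open>S\<close> of the
  integer matrix obtained by setting all indeterminates to 1 (\<open>det_one_plus_expansion\<close>).  Modulo 2 the signs disappear: the matrix records which chords of the
  rotation interlace, with ones on the diagonal at the non-orientable loops.  A minor is odd iff the
  corresponding matrix over the field with two elements has trivial kernel
  (\<open>odd_det_iff_trivial_kernel\<close>).

  On the topological side, the kernel is described by bit-valued functions on the corners of \<open>B\<close>.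
  Given a vector \<open>v\<close> on the edges, let a function stay constant along vertex arcs and change by
  \<open>v e\<close> across each segment of the edge \<open>e\<close>.  Such a labelling exists since every edge is met
  twice on the way around the vertex, and walking around the vertex from one end of \<open>e\<close> to the
  other shows that it changes along the free sides of \<open>e\<close> by the entry at \<open>e\<close> of the matrix times
  \<open>v\<close> (\<open>labelling_side\<close>).  For \<open>v\<close> supported on \<open>X\<close>, the labelling is therefore constant on every
  boundary component iff \<open>v\<close> lies in the kernel of the submatrix on \<open>X\<close>; it is globally constant
  iff \<open>v = 0\<close>.  As there is one boundary component iff every function that is constant on boundary
  components is constant, this happens iff the kernel is trivial
  (\<open>single_boundary_iff_trivial_kernel\<close>).
\<close>

text \<open>These two rules rewrite field operations on bits into Boolean connectives, which destroys the
  linear algebra below.\<close>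

declare add_bit_eq_xor [simp del] mult_bit_eq_and [simp del]

lemma bit_add_self: "a + a = (0 :: bit)"
  by (cases a) simp_all

lemma bit_add_self_left: "a + (a + b) = (b :: bit)"
  by (cases a; cases b) simp_all

section \<open>The reduction map is a ring homomorphism\<close>

lemma frag_cmul_eq_of_int: "frag_cmul c P = of_int c * (P :: 'a :: comm_monoid_add \<Rightarrow>\<^sub>0 int)"
proof (rule poly_mapping_eqI)
  fix k
  have "of_int c * P = Poly_Mapping.map ((*) c) P"
    by (metis mult_map_scale_conv_mult single_of_int of_int_eq_id id_apply)
  then show "Poly_Mapping.lookup (frag_cmul c P) k = Poly_Mapping.lookup (of_int c * P) k"
    by (simp add: Poly_Mapping.map.rep_eq when_def)
qed

text \<open>The reduction map is the linear extension of this map on monomials, that is, the extension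
  provided for free abelian groups; the induction principle of the latter then applies.\<close>

definition monomial_image :: "(nat \<times> nat \<Rightarrow>\<^sub>0 nat) \<Rightarrow> set_poly" where
  "monomial_image m = xset (\<Union>(i, j)\<in>Poly_Mapping.keys m. {i, j})"

text \<open>Exponents are natural numbers, so none cancel when monomials are multiplied and the supports
  simply unite.\<close>

lemma monomial_image_add: "monomial_image (m + m') = monomial_image m * monomial_image m'"
proof -
  have "Poly_Mapping.keys (m + m') = Poly_Mapping.keys m \<union> Poly_Mapping.keys m'"
    by (auto simp: in_keys_iff lookup_add)
  then show ?thesis
    by (simp add: monomial_image_def xset_mult)
qed

lemma reduction_map_eq_frag_extend: "reduction_map = frag_extend monomial_image"
  by (rule ext) (simp add: reduction_map_def frag_extend_def frag_cmul_eq_of_int monomial_image_def)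

lemma frag_of_mult: "frag_of a * frag_of b = frag_of (a + b)"
  by (simp add: mult_single)

lemma reduction_map_mult: "reduction_map (P * Q) = reduction_map P * reduction_map Q"
proof -
  have one: "reduction_map (frag_of a * Q) = monomial_image a * reduction_map Q" for a
    by (induction Q rule: frag_induction[OF subset_UNIV])
      (simp_all add: reduction_map_eq_frag_extend frag_of_mult monomial_image_add
        right_diff_distrib frag_extend_diff del: single_one)
  show ?thesis
    by (induction P rule: frag_induction[OF subset_UNIV])
      (simp_all add: one reduction_map_eq_frag_extend[symmetric] left_diff_distrib,
       simp_all add: one reduction_map_eq_frag_extend left_diff_distrib frag_extend_diff)
qed

lemma reduction_map_one: "reduction_map 1 = 1"
proof -
  have "reduction_map (frag_of 0) = monomial_image 0"
    by (simp add: reduction_map_eq_frag_extend del: single_one)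
  then show ?thesis
    by (simp add: monomial_image_def xset_empty)
qed

interpretation reduction: comm_ring_hom reduction_map
  by unfold_locales
    (simp_all add: reduction_map_mult reduction_map_one,
     simp_all add: reduction_map_eq_frag_extend frag_extend_add)

lemma reduction_map_xvar: "reduction_map (xvar i j) = xset {i, j}"
  by (simp add: reduction_map_def xvar_def)

lemma prod_xset:
  assumes "finite S"
  shows "(\<Prod>i\<in>S. xset (F i)) = xset (\<Union>i\<in>S. F i)"
  using assms by (induction S rule: finite_induct) (simp_all add: xset_empty xset_mult)

section \<open>Expansion of the determinant into principal minors\<close>

text \<open>A principal submatrix without re-indexing: replacing the rows outside \<open>S\<close> by unit rows keeps
  the size \<open>n\<close>, and the determinant is the principal minor on \<open>S\<close>.\<close>

definition unit_rows_outside :: "nat \<Rightarrow> nat set \<Rightarrow> (nat \<Rightarrow> nat \<Rightarrow> 'a :: zero_neq_one) \<Rightarrow> 'a mat" where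
  "unit_rows_outside n S c = mat n n (\<lambda>(i, j). if i \<in> S then c i j else of_bool (i = j))"

text \<open>Multiplying out \<open>a + \<delta>\<close> in every row of a Leibniz summand chooses a set \<open>S\<close> of rows that
  contribute \<open>a\<close>.  The other rows force the permutation to fix the complement of \<open>S\<close>, so it permutes
  \<open>S\<close>, and the symbols picked up along \<open>S\<close> multiply to \<open>x\<^sub>S\<close> whatever the permutation is.\<close>

lemma det_one_plus_expansion:
  fixes c :: "nat \<Rightarrow> nat \<Rightarrow> int" and b :: "nat \<Rightarrow> nat"
  shows "det (1\<^sub>m n + mat n n (\<lambda>(i, j). of_int (c i j) * xset {b i, b j}))
    = (\<Sum>S\<in>Pow {0..<n}. of_int (det (unit_rows_outside n S c)) * xset (b ` S))"
proof -
  let ?P = "{p. p permutes {0..<n}}"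
  let ?a = "\<lambda>p i. of_int (c i (p i)) * xset {b i, b (p i)}"
  let ?d = "\<lambda>p i. of_bool (i = p i)"
  have summand: "(\<Prod>i\<in>S. ?a p i) * (\<Prod>i\<in>{0..<n} - S. ?d p i)
      = of_int (\<Prod>i=0..<n. unit_rows_outside n S c $$ (i, p i)) * xset (b ` S)"
    if p: "p permutes {0..<n}" and S: "S \<subseteq> {0..<n}" for p S
  proof -
    have fin: "finite S" using S finite_subset by blast
    have split: "(\<Prod>i=0..<n. unit_rows_outside n S c $$ (i, p i))
        = (\<Prod>i\<in>S. c i (p i)) * (\<Prod>i\<in>{0..<n} - S. of_bool (i = p i))"
    proof -
      have "(\<Prod>i=0..<n. unit_rows_outside n S c $$ (i, p i))
          = (\<Prod>i\<in>S. unit_rows_outside n S c $$ (i, p i))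
            * (\<Prod>i\<in>{0..<n} - S. unit_rows_outside n S c $$ (i, p i))"
        using prod.subset_diff[OF S] by (simp add: mult.commute)
      also have "(\<Prod>i\<in>S. unit_rows_outside n S c $$ (i, p i)) = (\<Prod>i\<in>S. c i (p i))"
        using S p by (intro prod.cong) (auto simp: unit_rows_outside_def permutes_in_image)
      also have "(\<Prod>i\<in>{0..<n} - S. unit_rows_outside n S c $$ (i, p i))
          = (\<Prod>i\<in>{0..<n} - S. of_bool (i = p i))"
        using S p by (intro prod.cong) (auto simp: unit_rows_outside_def permutes_in_image)
      finally show ?thesis .
    qed
    show ?thesis
    proof (cases "\<forall>i\<in>{0..<n} - S. p i = i")
      case True
      then have "p permutes S"
        using p S by (intro permutes_superset[OF p]) auto
      then have "(\<Union>i\<in>S. {b i, b (p i)}) = b ` S"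
        using permutes_in_image by fastforce
      then have "(\<Prod>i\<in>S. xset {b i, b (p i)}) = xset (b ` S)"
        by (simp add: prod_xset[OF fin])
      then show ?thesis
        using True by (simp add: split prod.distrib)
    next
      case False
      then obtain i where i: "i \<in> {0..<n} - S" "i \<noteq> p i" by metis
      have "(\<Prod>i\<in>{0..<n} - S. ?d p i) = (0 :: set_poly)"
        by (rule prod_zero[OF _ bexI[of _ i]]) (use i in auto)
      moreover have "(\<Prod>i\<in>{0..<n} - S. of_bool (i = p i)) = (0 :: int)"
        by (rule prod_zero[OF _ bexI[of _ i]]) (use i in auto)
      ultimately show ?thesis
        by (simp only: split mult_zero_right mult_zero_left of_int_0)
    qed
  qed
  have "det (1\<^sub>m n + mat n n (\<lambda>(i, j). of_int (c i j) * xset {b i, b j}))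
      = (\<Sum>p\<in>?P. signof p * (\<Prod>i=0..<n. ?a p i + ?d p i))"
    by (subst det_def'[of _ n])
      (auto intro!: sum.cong prod.cong arg_cong2[of _ _ _ _ "(*)"] simp: permutes_in_image)
  also have "\<dots> = (\<Sum>p\<in>?P. \<Sum>S\<in>Pow {0..<n}. signof p *
      (of_int (\<Prod>i=0..<n. unit_rows_outside n S c $$ (i, p i)) * xset (b ` S)))"
    by (intro sum.cong refl) (simp add: prod_add sum_distrib_left summand)
  also have "\<dots> = (\<Sum>S\<in>Pow {0..<n}. \<Sum>p\<in>?P. signof p *
      (of_int (\<Prod>i=0..<n. unit_rows_outside n S c $$ (i, p i)) * xset (b ` S)))"
    by (rule sum.swap)
  also have "\<dots> = (\<Sum>S\<in>Pow {0..<n}. of_int (det (unit_rows_outside n S c)) * xset (b ` S))"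
    by (intro sum.cong refl)
      (simp add: det_def'[of _ n] unit_rows_outside_def sum_distrib_right mult.assoc)
  finally show ?thesis .
qed

text \<open>The unit rows force a kernel vector to vanish outside \<open>S\<close>; the remaining rows say that it is in
  the kernel of the principal submatrix.\<close>

lemma odd_det_iff_trivial_kernel:
  fixes c :: "nat \<Rightarrow> nat \<Rightarrow> int"
  assumes "S \<subseteq> {0..<n}"
  shows "odd (det (unit_rows_outside n S c)) \<longleftrightarrow>
    (\<forall>v :: nat \<Rightarrow> bit. (\<forall>i. i \<notin> S \<longrightarrow> v i = 0) \<and> (\<forall>i\<in>S. (\<Sum>j=0..<n. of_int (c i j) * v j) = 0)
      \<longrightarrow> (\<forall>i. v i = 0))"
proof -
  let ?h = "of_int :: int \<Rightarrow> bit"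
  let ?N = "unit_rows_outside n S (\<lambda>i j. ?h (c i j))"
  have N: "?N \<in> carrier_mat n n" by (simp add: unit_rows_outside_def)
  have "map_mat ?h (unit_rows_outside n S c) = ?N"
    by (rule eq_matI) (auto simp: unit_rows_outside_def)
  then have det: "?h (det (unit_rows_outside n S c)) = det ?N"
    by (metis of_int_hom.hom_det)
  have parity: "odd a \<longleftrightarrow> ?h a \<noteq> 0" for a
    by (cases "even a") (auto elim!: evenE oddE)
  have row: "row ?N i \<bullet> w = (if i \<in> S then \<Sum>j=0..<n. ?h (c i j) * w $ j else w $ i)"
    if "i < n" "w \<in> carrier_vec n" for i w
  proof -
    have "row ?N i \<bullet> w = (\<Sum>j=0..<n. (if i \<in> S then ?h (c i j) else of_bool (i = j)) * w $ j)"
      using that by (simp add: scalar_prod_def unit_rows_outside_def)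
    moreover have "(\<Sum>j=0..<n. of_bool (i = j) * w $ j) = w $ i"
    proof -
      have "(\<Sum>j=0..<n. of_bool (i = j) * w $ j) = (\<Sum>j=0..<n. if i = j then w $ j else 0)"
        by (intro sum.cong) simp_all
      then show ?thesis using that by simp
    qed
    ultimately show ?thesis by simp
  qed
  have kernel: "?N *\<^sub>v w = 0\<^sub>v n \<longleftrightarrow>
      (\<forall>i<n. if i \<in> S then (\<Sum>j=0..<n. ?h (c i j) * w $ j) = 0 else w $ i = 0)"
    if "w \<in> carrier_vec n" for w
    using that N row by (auto simp: vec_eq_iff simp del: bit_not_zero_iff bit_not_one_iff)
  have "even (det (unit_rows_outside n S c)) \<longleftrightarrow> 
      (\<exists>w. w \<in> carrier_vec n \<and> w \<noteq> 0\<^sub>v n \<and> ?N *\<^sub>v w = 0\<^sub>v n)"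
    using parity det det_0_iff_vec_prod_zero[OF N] by metis
  also have "\<dots> \<longleftrightarrow> (\<exists>v :: nat \<Rightarrow> bit. (\<forall>i. i \<notin> S \<longrightarrow> v i = 0) \<and>
      (\<forall>i\<in>S. (\<Sum>j=0..<n. ?h (c i j) * v j) = 0) \<and> (\<exists>i. v i \<noteq> 0))" (is "?L \<longleftrightarrow> ?R")
  proof
    assume ?L
    then obtain w where w: "w \<in> carrier_vec n" "w \<noteq> 0\<^sub>v n" "?N *\<^sub>v w = 0\<^sub>v n" by blast
    let ?v = "\<lambda>i. if i < n then w $ i else 0"
    have "\<forall>i. i \<notin> S \<longrightarrow> ?v i = 0"
      using w(3) unfolding kernel[OF w(1)] by auto
    moreover have "\<forall>i\<in>S. (\<Sum>j=0..<n. ?h (c i j) * ?v j) = 0"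
    proof
      fix i assume "i \<in> S"
      moreover have "(\<Sum>j=0..<n. ?h (c i j) * ?v j) = (\<Sum>j=0..<n. ?h (c i j) * w $ j)"
        by (rule sum.cong) simp_all
      moreover have "i < n" using \<open>i \<in> S\<close> assms by auto
      ultimately show "(\<Sum>j=0..<n. ?h (c i j) * ?v j) = 0"
        using w(3) unfolding kernel[OF w(1)] by (simp only: if_P)
    qed
    moreover have "\<exists>i. ?v i \<noteq> 0"
      using w(1,2) by (auto simp: vec_eq_iff)
    ultimately show ?R by (intro exI[of _ ?v] conjI)
  next
    assume ?R
    then obtain v i where v: "\<And>i. i \<notin> S \<Longrightarrow> v i = 0"
      "\<And>i. i \<in> S \<Longrightarrow> (\<Sum>j=0..<n. ?h (c i j) * v j) = 0" "v i \<noteq> 0" by blast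
    then have "i < n" using assms by fastforce
    then have "vec n v \<noteq> 0\<^sub>v n" using v(3) by (auto simp: vec_eq_iff)
    moreover have "?N *\<^sub>v vec n v = 0\<^sub>v n"
    proof -
      have "(\<Sum>j=0..<n. ?h (c i j) * vec n v $ j) = (\<Sum>j=0..<n. ?h (c i j) * v j)" for i
        by (rule sum.cong) simp_all
      then show ?thesis
        using v(1,2) by (subst kernel) simp_all
    qed
    ultimately show ?L by (intro exI[of _ "vec n v"]) simp
  qed
  finally show ?thesis by blast
qed

section \<open>Reading off coefficients modulo 2\<close>

lemma reduce_mod2_sum_xset:
  assumes "finite I" and "inj_on F I"
  shows "reduce_mod2 (\<Sum>S\<in>I. of_int (d S) * xset (F S)) = (\<Sum>S | S \<in> I \<and> odd (d S). xset (F S))"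
proof (rule poly_mapping_eqI)
  fix A
  have coeff: "Poly_Mapping.lookup (of_int a * xset Y) A = (if Index Y = A then a else 0)" for a Y
    by (simp add: frag_cmul_eq_of_int[symmetric] xset_def lookup_single when_def)
  have "Poly_Mapping.lookup (\<Sum>S\<in>I. of_int (d S) * xset (F S)) A mod 2
      = (\<Sum>S\<in>I. if Index (F S) = A then d S else 0) mod 2"
    by (simp add: lookup_sum coeff)
  also have "\<dots> = (\<Sum>S\<in>I. if Index (F S) = A then d S mod 2 else 0)"
  proof (cases "\<exists>S\<in>I. Index (F S) = A")
    case True
    then obtain S where S: "S \<in> I" "Index (F S) = A" by blast
    then have "Index (F S') = A \<longleftrightarrow> S' = S" if "S' \<in> I" for S'
      using assms(2) that by (auto dest: inj_onD)
    then show ?thesis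
      using S assms(1) by (simp cong: sum.cong)
  qed (simp cong: sum.cong)
  also have "\<dots> = (\<Sum>S\<in>I. if odd (d S) then (if Index (F S) = A then 1 else 0) else 0)"
    by (intro sum.cong) (auto simp: odd_iff_mod_2_eq_one)
  also have "\<dots> = (\<Sum>S | S \<in> I \<and> odd (d S). if Index (F S) = A then 1 else 0)"
    using assms(1) by (simp add: sum.inter_filter)
  also have "\<dots> = Poly_Mapping.lookup (\<Sum>S | S \<in> I \<and> odd (d S). xset (F S)) A"
    using coeff[of 1] by (simp add: lookup_sum)
  finally show "Poly_Mapping.lookup (reduce_mod2 (\<Sum>S\<in>I. of_int (d S) * xset (F S))) A
      = Poly_Mapping.lookup (\<Sum>S | S \<in> I \<and> odd (d S). xset (F S)) A"
    by (auto simp add: reduce_mod2_def Poly_Mapping.map.rep_eq when_def)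
qed

lemma eval_ones_sum_xset:
  assumes "finite \<X>"
  shows "eval_ones (\<Sum>X\<in>\<X>. xset X) = int (card \<X>)"
proof -
  have lookup: "Poly_Mapping.lookup (\<Sum>X\<in>\<X>. xset X) A = of_bool (elements A \<in> \<X>)" for A
  proof -
    have "Poly_Mapping.lookup (\<Sum>X\<in>\<X>. xset X) A = (\<Sum>X\<in>\<X>. if X = elements A then 1 else 0)"
      by (cases A) (auto simp: lookup_sum xset_def lookup_single when_def intro!: sum.cong)
    also have "\<dots> = of_bool (elements A \<in> \<X>)"
      using assms by simp
    finally show ?thesis .
  qed
  have "Poly_Mapping.keys (\<Sum>X\<in>\<X>. xset X) = Index ` \<X>"
  proof (rule Set.set_eqI)
    fix A :: "nat index_set"
    show "A \<in> Poly_Mapping.keys (\<Sum>X\<in>\<X>. xset X) \<longleftrightarrow> A \<in> Index ` \<X>"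
      by (cases A) (auto simp: in_keys_iff lookup)
  qed
  then show ?thesis
    by (simp add: eval_ones_def lookup sum.reindex inj_on_def)
qed

section \<open>Functions constant along curves\<close>

text \<open>For the interesting direction, the indicator function of a single curve is constant along curves;
  if it is constant, that curve contains every corner.\<close>

lemma card_curves_eq_1_iff:
  assumes s: "pairing_on C s" and t: "pairing_on C t" and "C \<noteq> {}"
  shows "card (curves C s t) = 1 \<longleftrightarrow>
    (\<forall>g :: 'f \<Rightarrow> bit. (\<forall>c\<in>C. g (s c) = g c \<and> g (t c) = g c) \<longrightarrow> (\<forall>c\<in>C. \<forall>d\<in>C. g c = g d))"
proof -
  define R where "R = {(c, d). c \<in> C \<and> (d = s c \<or> d = t c)}"
  have curves: "curves C s t = (\<lambda>c. R\<^sup>* `` {c}) ` C"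
    by (auto simp: curves_def R_def quotient_def)
  have closed: "d \<in> C" if "(c, d) \<in> R\<^sup>*" "c \<in> C" for c d
    using that
  proof (induction rule: rtrancl_induct)
    case (step y z)
    then show ?case using s t by (auto simp: R_def pairing_on_def)
  qed
  show ?thesis
  proof
    assume "card (curves C s t) = 1"
    then obtain K where "curves C s t = {K}" by (auto simp: card_1_singleton_iff)
    then have K: "R\<^sup>* `` {c} = K" if "c \<in> C" for c using that by (auto simp: curves)
    show "\<forall>g :: 'f \<Rightarrow> bit. (\<forall>c\<in>C. g (s c) = g c \<and> g (t c) = g c) \<longrightarrow> (\<forall>c\<in>C. \<forall>d\<in>C. g c = g d)"
    proof (intro allI impI ballI)
      fix g :: "'f \<Rightarrow> bit" and c d
      assume g: "\<forall>c\<in>C. g (s c) = g c \<and> g (t c) = g c" and "c \<in> C" "d \<in> C"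
      then have "(c, d) \<in> R\<^sup>*" using K[of c] K[of d] by blast
      then show "g c = g d"
        by (induction rule: rtrancl_induct) (use g in \<open>auto simp: R_def\<close>)
    qed
  next
    assume const: "\<forall>g :: 'f \<Rightarrow> bit. (\<forall>c\<in>C. g (s c) = g c \<and> g (t c) = g c)
      \<longrightarrow> (\<forall>c\<in>C. \<forall>d\<in>C. g c = g d)"
    have "R\<^sup>* `` {c} = C" if "c \<in> C" for c
    proof
      show "R\<^sup>* `` {c} \<subseteq> C" using closed that by blast
      let ?g = "\<lambda>d. of_bool ((c, d) \<in> R\<^sup>*) :: bit"
      have steps: "(d, s d) \<in> R" "(d, t d) \<in> R" "(s d, d) \<in> R" "(t d, d) \<in> R" if "d \<in> C" for d
        using that s t by (auto simp: R_def pairing_on_def)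
      have "(c, s d) \<in> R\<^sup>* \<longleftrightarrow> (c, d) \<in> R\<^sup>*" "(c, t d) \<in> R\<^sup>* \<longleftrightarrow> (c, d) \<in> R\<^sup>*" if "d \<in> C" for d
        using steps[OF that] by (meson rtrancl.rtrancl_into_rtrancl)+
      then have "\<forall>d\<in>C. ?g (s d) = ?g d \<and> ?g (t d) = ?g d" by simp
      then have "\<forall>c\<in>C. \<forall>d\<in>C. ?g c = ?g d"
        by (rule spec[OF const, of ?g, THEN mp])
      then have "?g c = ?g d" if "d \<in> C" for d
        using \<open>c \<in> C\<close> that by blast
      then show "C \<subseteq> R\<^sup>* `` {c}" by auto
    qed
    then have "curves C s t = {C}" using \<open>C \<noteq> {}\<close> by (auto simp: curves)
    then show "card (curves C s t) = 1" by simp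
  qed
qed

section \<open>Interlaced chords\<close>

text \<open>Interlacing decides whether an off-diagonal entry is nonzero; the choice between the two
  patterns affects only its sign.\<close>

definition interlaced :: "'e signed_seq \<Rightarrow> 'e \<Rightarrow> 'e \<Rightarrow> bool" where
  "interlaced \<sigma> i j \<longleftrightarrow>
     relative_order \<sigma> i j [(i, EndA), (j, EndA), (i, EndB), (j, EndB)] \<or>
     relative_order \<sigma> i j [(i, EndA), (j, EndB), (i, EndB), (j, EndA)]"

lemma ex_rotate_4_iff:
  "(\<exists>k. F = rotate k [a, b, c, d]) \<longleftrightarrow>
     F = [a, b, c, d] \<or> F = [b, c, d, a] \<or> F = [c, d, a, b] \<or> F = [d, a, b, c]" (is "?L \<longleftrightarrow> ?R")
proof -
  have rotations: "rotate 0 [a, b, c, d] = [a, b, c, d]" "rotate 1 [a, b, c, d] = [b, c, d, a]"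
    "rotate 2 [a, b, c, d] = [c, d, a, b]" "rotate 3 [a, b, c, d] = [d, a, b, c]"
    by (simp_all add: rotate_def numeral_2_eq_2 numeral_3_eq_3)
  show ?thesis
  proof
    assume ?L
    then obtain k where "F = rotate k [a, b, c, d]" by blast
    then have F: "F = rotate (k mod 4) [a, b, c, d]" by (subst (asm) rotate_conv_mod) simp
    have "k mod 4 = 0 \<or> k mod 4 = 1 \<or> k mod 4 = 2 \<or> k mod 4 = 3" by linarith
    then show ?R by (elim disjE) (simp_all only: F rotations simp_thms)
  next
    assume ?R
    then show ?L using rotations[symmetric] by (elim disjE) (simp only:, blast)+
  qed
qed

lemma interlaced_sym: "interlaced \<sigma> i j \<longleftrightarrow> interlaced \<sigma> j i"
proof -
  have eq: "filter (\<lambda>(e, l). e = i \<or> e = j) xs = filter (\<lambda>(e, l). e = j \<or> e = i) xs"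
    for xs :: "('a \<times> end_label) list"
    by (rule filter_cong) auto
  show ?thesis
    unfolding interlaced_def relative_order_def ex_rotate_4_iff eq by blast
qed

text \<open>Cutting the cyclic sequence open at any point leaves the two occurrences of \<open>j\<close> distributed over
  the three pieces \<open>u\<close>, \<open>v\<close>, \<open>w\<close>; they interlace with \<open>i\<close> iff exactly one of them lies in \<open>v\<close>.\<close>

lemma odd_between_iff_interlaced:
  fixes \<sigma> :: "'e signed_seq"
  assumes ls: "map (\<lambda>(e, l, s). (e, l)) \<sigma> = u @ (i, a) # v @ (i, b) # w"
    and dist: "distinct (u @ (i, a) # v @ (i, b) # w)"
    and j: "{(j, EndA), (j, EndB)} \<subseteq> set (u @ (i, a) # v @ (i, b) # w)" and "i \<noteq> j"
  shows "odd (length (filter (\<lambda>x. fst x = j) v)) \<longleftrightarrow> interlaced \<sigma> i j"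
proof -
  let ?P = "\<lambda>(e, l :: end_label). e = i \<or> e = j"
  let ?Q = "\<lambda>x :: 'e \<times> end_label. fst x = j"
  have label: "l = EndA \<or> l = EndB" for l by (cases l) auto
  have ab: "a = EndA \<and> b = EndB \<or> a = EndB \<and> b = EndA"
    using dist by (cases a; cases b) simp_all
  have filter_eq: "filter ?P y = filter ?Q y" if "y \<in> {u, v, w}" for y
  proof (rule filter_cong[OF refl])
    fix x assume "x \<in> set y"
    then have "x \<notin> {(i, a), (i, b)}" using that dist by auto
    then show "?P x = ?Q x" using ab label[of "snd x"] by (cases x) auto
  qed
  have F: "filter ?P (map (\<lambda>(e, l, s). (e, l)) \<sigma>)
      = filter ?Q u @ (i, a) # filter ?Q v @ (i, b) # filter ?Q w"
    by (simp add: ls filter_eq)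
  let ?D = "filter ?Q u @ filter ?Q v @ filter ?Q w"
  have dD: "distinct ?D" using dist by auto
  have sD: "set ?D = {(j, EndA), (j, EndB)}"
  proof
    show "set ?D \<subseteq> {(j, EndA), (j, EndB)}"
      using label by fastforce
    show "{(j, EndA), (j, EndB)} \<subseteq> set ?D" using j \<open>i \<noteq> j\<close> by auto
  qed
  have pair: "length zs = 2 \<Longrightarrow> \<exists>x y. zs = [x, y]" for zs :: "('e \<times> end_label) list"
    by (auto simp: numeral_2_eq_2 length_Suc_conv)
  have "length ?D = 2" using distinct_card[OF dD] sD by simp
  from pair[OF this] obtain x y where xy: "?D = [x, y]" by blast
  then have "{x, y} = {(j, EndA), (j, EndB)}" using sD by simp
  then have two: "x = (j, EndA) \<and> y = (j, EndB) \<or> x = (j, EndB) \<and> y = (j, EndA)"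
    by (simp only: doubleton_eq_iff)
  obtain fu fv fw where f: "filter ?Q u = fu" "filter ?Q v = fv" "filter ?Q w = fw" by blast
  have "(fu, fv, fw) \<in> {([x, y], [], []), ([x], [y], []), ([x], [], [y]),
      ([], [x, y], []), ([], [x], [y]), ([], [], [x, y])}"
    using xy unfolding f by (cases fu; cases "tl fu"; cases fv; cases "tl fv") auto
  then show ?thesis
    unfolding interlaced_def relative_order_def F ex_rotate_4_iff f
    using ab two \<open>i \<noteq> j\<close> by (elim insertE emptyE disjE conjE) (simp_all)
qed

section \<open>Labellings of the corners of a bouquet\<close>

text \<open>A traversal \<open>cs\<close> of the boundary circle of the vertex of a bouquet, with \<open>\<sigma>\<close> naming the half-edge
  met at each step.  The elements of \<open>cs\<close> are called entries and their images under the segments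
  exits; going around the vertex alternates between entries and exits.\<close>

locale traversed_bouquet =
  fixes B :: "('e, 'f, 'v) ribbon" and \<sigma> :: "'e signed_seq" and cs :: "'f list"
  assumes graph: "ribbon_graph B"
    and length_cs: "length cs = length \<sigma>"
    and distinct_cs: "distinct cs"
    and entries_disjoint_exits: "set cs \<inter> seg B ` set cs = {}"
    and corners_eq: "set cs \<union> seg B ` set cs = corners B"
    and next_entry: "k < length cs \<Longrightarrow> cs ! (Suc k mod length cs) = varc B (seg B (cs ! k))"
    and edge_at: "k < length cs \<Longrightarrow> fst (\<sigma> ! k) = edge_of B (cs ! k)"
    and distinct_ends: "distinct (map (\<lambda>(i, l, s). (i, l)) \<sigma>)"
    and set_ends: "set (map (\<lambda>(i, l, s). (i, l)) \<sigma>) = edges B \<times> {EndA, EndB}"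
begin

lemma seg_corner: "c \<in> corners B \<Longrightarrow> seg B c \<in> corners B"
  and side_corner: "c \<in> corners B \<Longrightarrow> side B c \<in> corners B"
  and seg_seg: "c \<in> corners B \<Longrightarrow> seg B (seg B c) = c"
  and side_side: "c \<in> corners B \<Longrightarrow> side B (side B c) = c"
  and varc_varc: "c \<in> corners B \<Longrightarrow> varc B (varc B c) = c"
  and seg_side: "c \<in> corners B \<Longrightarrow> seg B (side B c) = side B (seg B c)"
  and corners_of_edge: "c \<in> corners B \<Longrightarrow>
    {d \<in> corners B. edge_of B d = edge_of B c} = {c, seg B c, side B c, side B (seg B c)}"
  using graph unfolding ribbon_graph_def pairing_on_def by blast+

lemma edge_of_seg: "c \<in> corners B \<Longrightarrow> edge_of B (seg B c) = edge_of B c"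
  and edge_of_side: "c \<in> corners B \<Longrightarrow> edge_of B (side B c) = edge_of B c"
  using corners_of_edge by blast+

lemma entry_corner: "k < length cs \<Longrightarrow> cs ! k \<in> corners B"
  using corners_eq nth_mem by blast

lemma corner_cases:
  assumes "c \<in> corners B"
  obtains (entry) k where "k < length cs" "c = cs ! k"
    | (exit) k where "k < length cs" "c = seg B (cs ! k)"
proof -
  have "c \<in> set cs \<or> c \<in> seg B ` set cs" using assms corners_eq by blast
  then show thesis using entry exit by (auto simp: in_set_conv_nth)
qed

lemma exit_not_entry: "k < length cs \<Longrightarrow> seg B (cs ! k) \<notin> set cs"
  using entries_disjoint_exits by (metis IntI emptyE image_eqI nth_mem)

lemma preceding_exit:
  assumes "m < length cs"
  obtains k where "k < length cs" "cs ! m = varc B (seg B (cs ! k))"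
proof -
  define k where "k = (m + length cs - 1) mod length cs"
  have "0 < length cs" using assms by linarith
  then have k: "k < length cs" and "Suc k mod length cs = m"
    using assms by (simp_all add: k_def mod_Suc_eq)
  then have "cs ! m = varc B (seg B (cs ! k))" using next_entry[of k] by simp
  then show thesis using that k by blast
qed

lemma finite_edges: "finite (edges B)"
  using graph by (simp add: ribbon_graph_def edges_def)

lemma edge_at_edges: "k < length cs \<Longrightarrow> fst (\<sigma> ! k) \<in> edges B"
  using edge_at entry_corner by (simp add: edges_def)

lemma edge_positions:
  assumes "e \<in> edges B"
  obtains k l where "k < l" "l < length \<sigma>" "{t. t < length \<sigma> \<and> fst (\<sigma> ! t) = e} = {k, l}"
proof -
  define ls where "ls = map (\<lambda>(i, l, s). (i, l)) \<sigma>"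
  have len: "length ls = length \<sigma>" and dist: "distinct ls"
    using distinct_ends by (simp_all add: ls_def)
  have fst_ls: "fst (ls ! t) = fst (\<sigma> ! t)" if "t < length \<sigma>" for t
    using that by (simp add: ls_def case_prod_beta)
  have "(e, EndA) \<in> set ls" "(e, EndB) \<in> set ls"
    unfolding ls_def set_ends using assms by simp_all
  then obtain a b where a: "a < length \<sigma>" "ls ! a = (e, EndA)" and b: "b < length \<sigma>" "ls ! b = (e, EndB)"
    unfolding in_set_conv_nth len by blast
  have "t = a \<or> t = b" if t: "t < length \<sigma>" "fst (\<sigma> ! t) = e" for t
  proof (cases "snd (ls ! t)")
    case EndA
    then have "ls ! t = ls ! a" using t a fst_ls[OF t(1)] by (simp add: prod_eq_iff)
    then show ?thesis using nth_eq_iff_index_eq[OF dist, of t a] t a len by simp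
  next
    case EndB
    then have "ls ! t = ls ! b" using t b fst_ls[OF t(1)] by (simp add: prod_eq_iff)
    then show ?thesis using nth_eq_iff_index_eq[OF dist, of t b] t b len by simp
  qed
  moreover have "fst (\<sigma> ! a) = e" "fst (\<sigma> ! b) = e"
    using a b fst_ls[of a] fst_ls[of b] by simp_all
  ultimately have pos: "{t. t < length \<sigma> \<and> fst (\<sigma> ! t) = e} = {a, b}" using a b by blast
  have "a \<noteq> b" using a b by auto
  then consider "a < b" | "b < a" by linarith
  then show thesis
  proof cases
    case 1
    then show thesis using that[OF _ _ pos] b by blast
  next
    case 2
    then show thesis using that[of b a] pos a by (simp add: insert_commute)
  qed
qed

lemma odd_card_between_iff_interlaced:
  assumes "k < l" "l < length \<sigma>" "fst (\<sigma> ! k) = e" "fst (\<sigma> ! l) = e" "j \<in> edges B" "e \<noteq> j"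
  shows "odd (card {t \<in> {k<..<l}. fst (\<sigma> ! t) = j}) \<longleftrightarrow> interlaced \<sigma> e j"
proof -
  define ls where "ls = map (\<lambda>(i, l, s). (i, l)) \<sigma>"
  define mid where "mid = drop (Suc k) (take l ls)"
  have len: "length ls = length \<sigma>" and len_mid: "length mid = l - Suc k"
    using assms by (simp_all add: ls_def mid_def)
  have fst_ls: "fst (ls ! t) = fst (\<sigma> ! t)" if "t < length \<sigma>" for t
    using that by (simp add: ls_def case_prod_beta)
  have nth_mid: "fst (mid ! i) = fst (\<sigma> ! (Suc k + i))" if "i < l - Suc k" for i
    using that assms fst_ls[of "Suc k + i"] len by (simp add: mid_def)
  have "fst (ls ! k) = e" "fst (ls ! l) = e"
    using assms fst_ls[of k] fst_ls[of l] by simp_all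
  then obtain a b where ends: "ls ! k = (e, a)" "ls ! l = (e, b)"
    by (metis prod.collapse)
  have right: "ls = take l ls @ (e, b) # drop (Suc l) ls"
    using id_take_nth_drop[of l ls] assms(2) len ends(2) by simp
  have left: "take l ls = take k (take l ls) @ (e, a) # mid"
    using id_take_nth_drop[of k "take l ls"] assms(1,2) len ends(1) by (simp add: mid_def)
  define u w where "u = take k (take l ls)" and "w = drop (Suc l) ls"
  have split: "ls = u @ (e, a) # mid @ (e, b) # w"
    using trans[OF right arg_cong[OF left, of "\<lambda>x. x @ (e, b) # drop (Suc l) ls"]]
    by (simp only: append.assoc append_Cons u_def w_def)
  have "odd (length (filter (\<lambda>x. fst x = j) mid)) \<longleftrightarrow> interlaced \<sigma> e j"
  proof (rule odd_between_iff_interlaced)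
    show "map (\<lambda>(i, l, s). (i, l)) \<sigma> = u @ (e, a) # mid @ (e, b) # w"
      using split by (simp only: ls_def)
    show "distinct (u @ (e, a) # mid @ (e, b) # w)"
      using distinct_ends by (simp only: ls_def[symmetric] split[symmetric])
    have "{(j, EndA), (j, EndB)} \<subseteq> set ls"
      unfolding ls_def set_ends using assms by blast
    then show "{(j, EndA), (j, EndB)} \<subseteq> set (u @ (e, a) # mid @ (e, b) # w)"
      by (simp only: split[symmetric])
  qed fact
  moreover have "length (filter (\<lambda>x. fst x = j) mid) = card {i. i < l - Suc k \<and> fst (mid ! i) = j}"
    by (simp add: length_filter_conv_card len_mid)
  moreover have "card {i. i < l - Suc k \<and> fst (mid ! i) = j} = card {t \<in> {k<..<l}. fst (\<sigma> ! t) = j}"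
  proof (rule bij_betw_same_card[of "\<lambda>i. Suc k + i"], rule bij_betwI[where g = "\<lambda>t. t - Suc k"])
    show "(\<lambda>i. Suc k + i) \<in> {i. i < l - Suc k \<and> fst (mid ! i) = j} \<rightarrow> {t \<in> {k<..<l}. fst (\<sigma> ! t) = j}"
      using nth_mid by auto
    show "(\<lambda>t. t - Suc k) \<in> {t \<in> {k<..<l}. fst (\<sigma> ! t) = j} \<rightarrow> {i. i < l - Suc k \<and> fst (mid ! i) = j}"
      using nth_mid by auto
  qed auto
  ultimately show ?thesis by simp
qed

text \<open>The entry at \<open>e\<close> of the product of \<open>v\<close> with the skew-adjacency matrix modulo 2, all
  indeterminates being set to 1.\<close>

definition adjacency_row :: "('e \<Rightarrow> bit) \<Rightarrow> 'e \<Rightarrow> bit" where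
  "adjacency_row v e = (if orientable_loop B e then 0 else v e)
     + (\<Sum>j\<in>edges B - {e}. of_bool (interlaced \<sigma> e j) * v j)"

text \<open>An edge with no end or both ends between the two ends of \<open>e\<close> contributes \<open>0\<close> modulo 2, so only
  the edges interlaced with \<open>e\<close> survive.\<close>

lemma sum_between:
  fixes v :: "'e \<Rightarrow> bit"
  assumes kl: "k < l" "l < length \<sigma>" and pos: "{t. t < length \<sigma> \<and> fst (\<sigma> ! t) = e} = {k, l}"
  shows "(\<Sum>t\<in>{k<..<l}. v (fst (\<sigma> ! t))) = (\<Sum>j\<in>edges B - {e}. of_bool (interlaced \<sigma> e j) * v j)"
proof -
  have ends: "fst (\<sigma> ! k) = e" "fst (\<sigma> ! l) = e" using pos by blast+
  have sub: "(\<lambda>t. fst (\<sigma> ! t)) ` {k<..<l} \<subseteq> edges B - {e}"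
  proof
    fix j assume "j \<in> (\<lambda>t. fst (\<sigma> ! t)) ` {k<..<l}"
    then obtain t where t: "k < t" "t < l" "j = fst (\<sigma> ! t)" by auto
    then have "t \<notin> {k, l}" "t < length \<sigma>" using kl by auto
    then have "fst (\<sigma> ! t) \<noteq> e" using pos by blast
    then show "j \<in> edges B - {e}" using t \<open>t < length \<sigma>\<close> edge_at_edges length_cs by auto
  qed
  have "(\<Sum>t\<in>{k<..<l}. v (fst (\<sigma> ! t)))
      = (\<Sum>j\<in>edges B - {e}. \<Sum>t | t \<in> {k<..<l} \<and> fst (\<sigma> ! t) = j. v (fst (\<sigma> ! t)))"
    using sum.group[OF _ _ sub, of "\<lambda>t. v (fst (\<sigma> ! t))"] finite_edges by simp
  also have "\<dots> = (\<Sum>j\<in>edges B - {e}. of_bool (interlaced \<sigma> e j) * v j)"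
  proof (rule sum.cong[OF refl])
    fix j assume j: "j \<in> edges B - {e}"
    have parity: "of_nat m = (of_bool (odd m) :: bit)" for m
      by (cases "even m") (auto elim!: evenE oddE)
    have "(\<Sum>t | t \<in> {k<..<l} \<and> fst (\<sigma> ! t) = j. v (fst (\<sigma> ! t)))
        = (\<Sum>t | t \<in> {k<..<l} \<and> fst (\<sigma> ! t) = j. v j)"
      by (rule sum.cong) auto
    also have "\<dots> = of_nat (card {t \<in> {k<..<l}. fst (\<sigma> ! t) = j}) * v j"
      by simp
    also have "\<dots> = of_bool (interlaced \<sigma> e j) * v j"
      using odd_card_between_iff_interlaced[OF kl ends] j parity by auto
    finally show "(\<Sum>t | t \<in> {k<..<l} \<and> fst (\<sigma> ! t) = j. v (fst (\<sigma> ! t)))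
        = of_bool (interlaced \<sigma> e j) * v j" .
  qed
  finally show ?thesis .
qed

text \<open>If \<open>g\<close> is the indicator function of a union of boundary components of the spanning subgraph with
  edge set \<open>X\<close>, then for \<open>e \<in> X\<close> the bit \<open>v e\<close> tells whether the two free sides of the ribbon carry
  different values, and \<open>v\<close> vanishes outside \<open>X\<close>.\<close>

definition labelling :: "('f \<Rightarrow> bit) \<Rightarrow> ('e \<Rightarrow> bit) \<Rightarrow> bool" where
  "labelling g v \<longleftrightarrow>
     (\<forall>c\<in>corners B. g (varc B c) = g c \<and> g (seg B c) = g c + v (edge_of B c))"

lemma labelling_entry:
  assumes g: "labelling g v" and "k < length cs"
  shows "g (cs ! k) = g (cs ! 0) + (\<Sum>t<k. v (fst (\<sigma> ! t)))"
  using assms(2)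
proof (induction k)
  case (Suc k)
  then have k: "k < length cs" "cs ! k \<in> corners B" by (simp_all add: entry_corner)
  have "g (cs ! Suc k) = g (varc B (seg B (cs ! k)))"
    using next_entry[OF k(1)] Suc.prems by simp
  also have "\<dots> = g (cs ! k) + v (edge_of B (cs ! k))"
    using g k seg_corner by (auto simp: labelling_def)
  finally show ?case using Suc.IH k edge_at by (simp add: add.assoc)
qed simp

text \<open>Sum the values of \<open>v\<close> passed on the way around the vertex.  Nothing obstructs closing up
  after one turn, since each edge is passed twice and contributes \<open>0\<close> in total.\<close>

lemma ex_labelling:
  fixes v :: "'e \<Rightarrow> bit"
  shows "\<exists>g. labelling g v"
proof -
  define L where "L = length cs"
  define h where "h k = (\<Sum>t<k. v (fst (\<sigma> ! t)))" for k
  define pos where "pos c = (SOME k. k < L \<and> cs ! k = c)" for c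
  define g where "g c = (if c \<in> set cs then h (pos c) else h (Suc (pos (seg B c))))" for c
  have pos: "pos (cs ! k) = k" if "k < L" for k
    unfolding pos_def using that distinct_cs
    by (intro some_equality) (auto simp: L_def nth_eq_iff_index_eq)
  have entry: "g (cs ! k) = h k" if "k < L" for k
    using that pos by (simp add: g_def L_def)
  have exit: "g (seg B (cs ! k)) = h (Suc k)" if "k < L" for k
    using that pos exit_not_entry seg_seg entry_corner by (simp add: g_def L_def)
  have "h L = 0"
  proof -
    have "h L = (\<Sum>e\<in>edges B. \<Sum>t | t \<in> {..<L} \<and> fst (\<sigma> ! t) = e. v (fst (\<sigma> ! t)))"
      unfolding h_def
      by (rule sum.group[symmetric]) (use finite_edges edge_at_edges L_def in auto)
    also have "\<dots> = 0"
    proof (rule sum.neutral, rule ballI)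
      fix e assume "e \<in> edges B"
      then obtain k l where "k < l" "{t. t < length \<sigma> \<and> fst (\<sigma> ! t) = e} = {k, l}"
        using edge_positions by metis
      moreover from this have "fst (\<sigma> ! k) = e" "fst (\<sigma> ! l) = e" by blast+
      ultimately show "(\<Sum>t | t \<in> {..<L} \<and> fst (\<sigma> ! t) = e. v (fst (\<sigma> ! t))) = 0"
        by (simp add: L_def length_cs bit_add_self)
    qed
    finally show ?thesis .
  qed
  then have next_h: "h (Suc k mod L) = h (Suc k)" if "k < L" for k
    using that by (cases "Suc k = L") (simp_all add: h_def)
  have next_g: "g (varc B (seg B (cs ! k))) = g (seg B (cs ! k))" if "k < L" for k
  proof -
    have "Suc k mod L < L" using that by (intro mod_less_divisor) linarith
    then have "g (varc B (seg B (cs ! k))) = h (Suc k mod L)"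
      using next_entry[of k] entry[of "Suc k mod L"] that by (simp add: L_def)
    then show ?thesis using exit next_h that by simp
  qed
  have "labelling g v"
    unfolding labelling_def
  proof (intro ballI conjI)
    fix c assume c: "c \<in> corners B"
    then show "g (varc B c) = g c"
    proof (cases rule: corner_cases)
      case (entry m)
      obtain k where k: "k < length cs" "cs ! m = varc B (seg B (cs ! k))"
        by (rule preceding_exit[OF entry(1)])
      have "seg B (cs ! k) \<in> corners B" using k(1) entry_corner seg_corner by simp
      then show ?thesis using next_g[of k] varc_varc entry(2) k by (simp add: L_def)
    next
      case (exit k)
      then show ?thesis using next_g by (simp add: L_def)
    qed
    from c show "g (seg B c) = g c + v (edge_of B c)"
    proof (cases rule: corner_cases)
      case e: (entry k)
      then show ?thesis using entry exit edge_at by (simp add: L_def h_def)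
    next
      case e: (exit k)
      then have "seg B c = cs ! k" "edge_of B c = fst (\<sigma> ! k)"
        using seg_seg edge_of_seg edge_at entry_corner by simp_all
      then show ?thesis
        using e entry[of k] exit[of k] by (simp add: L_def h_def add.assoc bit_add_self)
    qed
  qed
  then show ?thesis by blast
qed

text \<open>An orientation of the vertex disc has to separate entries from exits.  It extends over the
  ribbon iff the free sides of the ribbon also join entries to exits.\<close>

lemma orientable_loop_iff_side_exit:
  assumes "k < length cs"
  shows "orientable_loop B (fst (\<sigma> ! k)) \<longleftrightarrow> side B (cs ! k) \<notin> set cs"
proof
  assume "orientable_loop B (fst (\<sigma> ! k))"
  then obtain m :: "'f \<Rightarrow> bool" where alternating: "\<forall>c\<in>corners B. m (varc B c) \<noteq> m c \<and>
      m (seg B c) \<noteq> m c \<and> (edge_of B c \<in> {fst (\<sigma> ! k)} \<longrightarrow> m (side B c) \<noteq> m c)"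
    unfolding orientable_loop_def orientable_spanning_def by (elim exE)
  have m: "m (varc B c) \<noteq> m c" "m (seg B c) \<noteq> m c"
      "edge_of B c = fst (\<sigma> ! k) \<Longrightarrow> m (side B c) \<noteq> m c" if "c \<in> corners B" for c
    using bspec[OF alternating that] by simp_all
  have const: "m (cs ! t) = m (cs ! 0)" if "t < length cs" for t
    using that
  proof (induction t)
    case (Suc t)
    then have "cs ! Suc t = varc B (seg B (cs ! t))" using next_entry[of t] by simp
    then show ?case
      using m(1)[of "seg B (cs ! t)"] m(2)[of "cs ! t"] Suc entry_corner[of t] seg_corner by auto
  qed simp
  show "side B (cs ! k) \<notin> set cs"
  proof
    assume "side B (cs ! k) \<in> set cs"
    then obtain t where "t < length cs" "side B (cs ! k) = cs ! t"
      by (metis in_set_conv_nth)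
    then have "m (side B (cs ! k)) = m (cs ! k)"
      using const[of t] const[OF assms] by simp
    then show False using m(3)[of "cs ! k"] edge_at[of k] entry_corner[of k] assms by simp
  qed
next
  assume side_k: "side B (cs ! k) \<notin> set cs"
  let ?m = "\<lambda>c. c \<in> set cs"
  have exit_entry: "seg B c \<in> set cs \<longleftrightarrow> c \<notin> set cs" if "c \<in> corners B" for c
    using that
  proof (cases rule: corner_cases)
    case (entry t)
    then show ?thesis using exit_not_entry by simp
  next
    case (exit t)
    then show ?thesis using exit_not_entry seg_seg entry_corner by simp
  qed
  have varc_exit: "varc B (seg B (cs ! t)) \<in> set cs" if "t < length cs" for t
  proof -
    have "Suc t mod length cs < length cs" using that by (intro mod_less_divisor) linarith
    then show ?thesis using next_entry[OF that] by (metis nth_mem)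
  qed
  have varc_iff: "varc B c \<in> set cs \<longleftrightarrow> c \<notin> set cs" if c: "c \<in> corners B" for c
  proof -
    have *: "d \<notin> set cs \<Longrightarrow> varc B d \<in> set cs" if "d \<in> corners B" for d
      using that varc_exit by (cases rule: corner_cases) auto
    have "varc B c \<notin> set cs" if "c \<in> set cs"
    proof -
      obtain m where m: "m < length cs" "c = cs ! m" using \<open>c \<in> set cs\<close> by (auto simp: in_set_conv_nth)
      obtain k where k: "k < length cs" "cs ! m = varc B (seg B (cs ! k))"
        by (rule preceding_exit[OF m(1)])
      have "seg B (cs ! k) \<in> corners B" using k(1) entry_corner seg_corner by simp
      then show ?thesis using varc_varc exit_not_entry[OF k(1)] m(2) k(2) by simp
    qed
    then show ?thesis using *[OF c] by blast
  qed
  have side_iff: "side B c \<in> set cs \<longleftrightarrow> c \<notin> set cs"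
    if c: "c \<in> corners B" "edge_of B c = fst (\<sigma> ! k)" for c
  proof -
    let ?p = "cs ! k"
    have p: "?p \<in> corners B" "?p \<in> set cs" using assms entry_corner by simp_all
    have "edge_of B c = edge_of B ?p" using c(2) edge_at[OF assms] by simp
    then have "c \<in> {?p, seg B ?p, side B ?p, seg B (side B ?p)}"
      unfolding seg_side[OF p(1)] corners_of_edge[OF p(1), symmetric] using c(1) by simp
    then consider "c = ?p" | "c = seg B ?p" | "c = side B ?p" | "c = seg B (side B ?p)" by blast
    then show ?thesis
    proof cases
      case 1
      then show ?thesis using side_k p(2) by simp
    next
      case 2
      then show ?thesis
        using side_k p(2) exit_entry[OF p(1)] exit_entry[OF side_corner[OF p(1)]] seg_side[OF p(1)] by simp
    next
      case 3
      then show ?thesis using side_k p(2) side_side[OF p(1)] by simp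
    next
      case 4
      then show ?thesis
        using side_k p exit_entry[OF p(1)] exit_entry[OF side_corner[OF p(1)]] seg_side[OF p(1)]
          side_side[OF seg_corner[OF p(1)]] by simp
    qed
  qed
  show "orientable_loop B (fst (\<sigma> ! k))"
    unfolding orientable_loop_def orientable_spanning_def
    using varc_iff exit_entry side_iff by (intro exI[of _ ?m]) auto
qed

text \<open>Walking around the vertex from the first end of \<open>e\<close> to its second collects \<open>v e\<close> at the first end
  and the interlaced edges in between.  For a non-orientable loop, the free side from the entry of
  the first end leads to the entry of the second; for an orientable loop it leads to the exit there,
  so the walk continues past the second end and collects \<open>v e\<close> again, which cancels it.\<close>

lemma labelling_side_entry:
  assumes g: "labelling g v" and k: "k < length cs"
  shows "g (side B (cs ! k)) = g (cs ! k) + adjacency_row v (fst (\<sigma> ! k))"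
proof -
  have ordered: "g (side B (cs ! k)) = g (cs ! k) + adjacency_row v e"
    if kl: "k < l" "l < length \<sigma>" and pos: "{t. t < length \<sigma> \<and> fst (\<sigma> ! t) = e} = {k, l}" for k l e
  proof -
    define M where "M = (\<Sum>j\<in>edges B - {e}. of_bool (interlaced \<sigma> e j) * v j)"
    have k: "k < length cs" and l: "l < length cs" using kl length_cs by simp_all
    have ends: "fst (\<sigma> ! k) = e" "fst (\<sigma> ! l) = e" using pos by blast+
    have edge: "edge_of B (cs ! k) = e" "edge_of B (cs ! l) = e"
      using ends edge_at[OF k] edge_at[OF l] by simp_all
    have "{..<l} = {..<k} \<union> ({k} \<union> {k<..<l})" using kl by auto
    moreover have "(\<Sum>t\<in>{..<k} \<union> ({k} \<union> {k<..<l}). v (fst (\<sigma> ! t)))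
        = (\<Sum>t<k. v (fst (\<sigma> ! t))) + (v e + (\<Sum>t\<in>{k<..<l}. v (fst (\<sigma> ! t))))"
      by (subst sum.union_disjoint, simp, simp, fastforce)+ (simp add: ends)
    ultimately have "g (cs ! l) = g (cs ! k) + (v e + M)"
      using labelling_entry[OF g k] labelling_entry[OF g l] sum_between[OF kl pos, of v]
      by (simp add: M_def add.assoc)
    moreover have "g (seg B (cs ! l)) = g (cs ! l) + v e"
      using g entry_corner[OF l] edge by (simp add: labelling_def)
    ultimately have g_values: "g (cs ! l) = g (cs ! k) + (v e + M)" "g (seg B (cs ! l)) = g (cs ! k) + M"
      by (simp_all add: ac_simps bit_add_self bit_add_self_left)
    have "cs ! l \<noteq> cs ! k" using kl k l distinct_cs by (simp add: nth_eq_iff_index_eq)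
    moreover have "cs ! l \<noteq> seg B (cs ! k)" using exit_not_entry[OF k] l by (metis nth_mem)
    moreover have "cs ! l \<in> {cs ! k, seg B (cs ! k), side B (cs ! k), side B (seg B (cs ! k))}"
      using corners_of_edge[OF entry_corner[OF k]] entry_corner[OF l] edge by blast
    ultimately have "side B (cs ! k) = cs ! l \<or> side B (cs ! k) = seg B (cs ! l)"
      using seg_side seg_seg side_corner entry_corner[OF k] by (metis insert_iff singletonD)
    then show ?thesis
    proof
      assume side: "side B (cs ! k) = cs ! l"
      then have "\<not> orientable_loop B e"
        using orientable_loop_iff_side_exit[OF k] ends l by simp
      then show ?thesis using side g_values by (simp add: adjacency_row_def M_def)
    next
      assume side: "side B (cs ! k) = seg B (cs ! l)"
      then have "orientable_loop B e"
        using orientable_loop_iff_side_exit[OF k] ends exit_not_entry[OF l] by simp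
      then show ?thesis using side g_values by (simp add: adjacency_row_def M_def)
    qed
  qed
  define e where "e = fst (\<sigma> ! k)"
  obtain k' l where kl: "k' < l" "l < length \<sigma>" and pos: "{t. t < length \<sigma> \<and> fst (\<sigma> ! t) = e} = {k', l}"
    by (rule edge_positions[OF edge_at_edges[OF k], folded e_def])
  have "k \<in> {t. t < length \<sigma> \<and> fst (\<sigma> ! t) = e}" using k length_cs by (simp add: e_def)
  then consider "k = k'" | "k = l" using pos by blast
  then show ?thesis
  proof cases
    case 1
    then show ?thesis using ordered[OF kl pos] by (simp add: e_def)
  next
    case 2
    \<comment> \<open>The rule at one corner of an edge passes to the other three, because \<open>seg\<close> and \<open>side\<close> commute;
      it is known at the entry \<open>p\<close> of the first end.\<close>
    define p where "p = cs ! k'"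
    have p: "p \<in> corners B" "edge_of B p = e"
    proof -
      have "k' < length cs" "fst (\<sigma> ! k') = e" using kl length_cs pos by auto
      then show "p \<in> corners B" "edge_of B p = e"
        using entry_corner edge_at by (simp_all add: p_def)
    qed
    have side_p: "g (side B p) = g p + adjacency_row v e"
      using ordered[OF kl pos] by (simp add: p_def)
    have "g (side B c) = g c + adjacency_row v e"
      if "c \<in> {p, seg B p, side B p, side B (seg B p)}" for c
    proof -
      have seg_p: "g (seg B p) = g p + v e"
        using g p by (simp add: labelling_def)
      have "g (side B (seg B p)) = g (side B p) + v e"
        using g p side_corner edge_of_side seg_side by (simp add: labelling_def flip: seg_side)
      then show ?thesis
        using that side_p seg_p p side_side seg_corner
        by (auto simp: ac_simps bit_add_self bit_add_self_left)
    qed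
    moreover have "cs ! k \<in> {p, seg B p, side B p, side B (seg B p)}"
      using corners_of_edge[OF p(1)] p(2) entry_corner[OF k] edge_at[OF k] by (auto simp: e_def)
    ultimately show ?thesis by (simp add: e_def)
  qed
qed

lemma labelling_side:
  assumes g: "labelling g v" and c: "c \<in> corners B"
  shows "g (side B c) = g c + adjacency_row v (edge_of B c)"
  using c
proof (cases rule: corner_cases)
  case (entry k)
  then show ?thesis using labelling_side_entry[OF g] edge_at by simp
next
  case (exit k)
  let ?p = "cs ! k"
  have p: "?p \<in> corners B" using exit entry_corner by simp
  have "g (side B c) = g (side B ?p) + v (edge_of B ?p)"
    using g p exit side_corner edge_of_side seg_side by (simp add: labelling_def flip: seg_side)
  moreover have "g c = g ?p + v (edge_of B ?p)"
    using g p exit by (simp add: labelling_def)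
  moreover have "edge_of B c = edge_of B ?p"
    using exit p edge_of_seg by simp
  ultimately show ?thesis
    using labelling_side_entry[OF g] exit edge_at by (simp add: ac_simps)
qed

text \<open>A kernel vector yields a labelling that is constant along the boundary; conversely a function
  constant along the boundary is a labelling for the vector of its jumps, which lies in the
  kernel.\<close>

lemma single_boundary_iff_trivial_kernel:
  assumes X: "X \<subseteq> edges B" and nonempty: "corners B \<noteq> {}"
  shows "card (curves (corners B) (varc B) (\<lambda>c. if edge_of B c \<in> X then side B c else seg B c)) = 1
    \<longleftrightarrow> (\<forall>v. (\<forall>e. e \<notin> X \<longrightarrow> v e = 0) \<and> (\<forall>e\<in>X. adjacency_row v e = 0) \<longrightarrow> (\<forall>e. v e = 0))"
    (is "card (curves _ _ ?t) = 1 \<longleftrightarrow> ?kernel")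
proof -
  have varc: "pairing_on (corners B) (varc B)"
    using graph by (simp add: ribbon_graph_def)
  have t: "pairing_on (corners B) ?t"
    using graph edge_of_side edge_of_seg by (auto simp: ribbon_graph_def pairing_on_def)
  have "card (curves (corners B) (varc B) ?t) = 1 \<longleftrightarrow>
      (\<forall>g :: 'f \<Rightarrow> bit. (\<forall>c\<in>corners B. g (varc B c) = g c \<and> g (?t c) = g c)
        \<longrightarrow> (\<forall>c\<in>corners B. \<forall>d\<in>corners B. g c = g d))"
    by (rule card_curves_eq_1_iff[OF varc t nonempty])
  also have "\<dots> \<longleftrightarrow> ?kernel"
  proof
    assume const: "\<forall>g :: 'f \<Rightarrow> bit. (\<forall>c\<in>corners B. g (varc B c) = g c \<and> g (?t c) = g c)
        \<longrightarrow> (\<forall>c\<in>corners B. \<forall>d\<in>corners B. g c = g d)"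
    show ?kernel
    proof (intro allI impI)
      fix v :: "'e \<Rightarrow> bit" and e
      assume v: "(\<forall>e. e \<notin> X \<longrightarrow> v e = 0) \<and> (\<forall>e\<in>X. adjacency_row v e = 0)"
      obtain g where g: "labelling g v" using ex_labelling by blast
      have "g (?t c) = g c" if "c \<in> corners B" for c
        using that g v labelling_side[OF g that] by (simp add: labelling_def)
      then have "\<forall>c\<in>corners B. g (varc B c) = g c \<and> g (?t c) = g c"
        using g by (simp add: labelling_def)
      then have g_const: "\<forall>c\<in>corners B. \<forall>d\<in>corners B. g c = g d"
        by (rule spec[OF const, THEN mp])
      show "v e = 0"
      proof (cases "e \<in> X")
        case True
        then obtain c where c: "c \<in> corners B" "e = edge_of B c"
          using X by (auto simp: edges_def)
        then have "g (seg B c) = g c" using g_const seg_corner by blast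
        then have "g c + v e = g c" using g c by (simp add: labelling_def)
        then show ?thesis by simp
      qed (use v in blast)
    qed
  next
    assume kernel: ?kernel
    show "\<forall>g :: 'f \<Rightarrow> bit. (\<forall>c\<in>corners B. g (varc B c) = g c \<and> g (?t c) = g c)
        \<longrightarrow> (\<forall>c\<in>corners B. \<forall>d\<in>corners B. g c = g d)"
    proof (intro allI impI)
      fix g :: "'f \<Rightarrow> bit"
      assume inv: "\<forall>c\<in>corners B. g (varc B c) = g c \<and> g (?t c) = g c"
      \<comment> \<open>The jump across a segment is the same at both ends of an edge of \<open>X\<close>, because \<open>g\<close> is
        constant along its free sides; so any corner of the edge can be used to read it off.\<close>
      define rep where "rep e = (SOME c. c \<in> corners B \<and> edge_of B c = e)" for e
      define v where "v e = (if e \<in> X then g (rep e) + g (seg B (rep e)) else 0)" for e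
      have jump: "g (seg B c) = g c + v (edge_of B c)" if c: "c \<in> corners B" for c
      proof (cases "edge_of B c \<in> X")
        case True
        let ?r = "rep (edge_of B c)"
        have r: "?r \<in> corners B" "edge_of B ?r = edge_of B c"
          using someI[of "\<lambda>d. d \<in> corners B \<and> edge_of B d = edge_of B c" c] c
          by (simp_all add: rep_def)
        have side: "g (side B d) = g d" if "d \<in> corners B" "edge_of B d = edge_of B c" for d
          using inv that True by auto
        have g_values: "g (side B ?r) = g ?r" "g (side B (seg B ?r)) = g (seg B ?r)"
          using side r seg_corner edge_of_seg by simp_all
        have "c \<in> {?r, seg B ?r, side B ?r, side B (seg B ?r)}"
          using corners_of_edge[OF r(1)] c r(2) by auto
        then have "g c + g (seg B c) = g ?r + g (seg B ?r)"
        proof (elim insertE emptyE)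
          assume "c = seg B ?r"
          then show ?thesis using seg_seg[OF r(1)] by (simp add: add.commute)
        next
          assume "c = side B ?r"
          then show ?thesis using g_values seg_side[OF r(1)] by simp
        next
          assume "c = side B (seg B ?r)"
          then have "seg B c = side B ?r"
            using seg_side[of "seg B ?r"] seg_seg seg_corner r by simp
          then show ?thesis using g_values \<open>c = side B (seg B ?r)\<close> by (simp add: add.commute)
        qed simp
        then show ?thesis
          using True bit_add_self_left[of "g c" "g (seg B c)"] by (simp add: v_def)
      next
        case False
        then show ?thesis using inv c by (auto simp: v_def)
      qed
      then have g: "labelling g v" using inv by (simp add: labelling_def)
      have "adjacency_row v e = 0" if "e \<in> X" for e
      proof -
        obtain c where c: "c \<in> corners B" "e = edge_of B c" using X \<open>e \<in> X\<close> by (auto simp: edges_def)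
        then have "g c + adjacency_row v e = g c"
          using labelling_side[OF g c(1)] inv \<open>e \<in> X\<close> by auto
        then show ?thesis by simp
      qed
      then have "(\<forall>e. e \<notin> X \<longrightarrow> v e = 0) \<and> (\<forall>e\<in>X. adjacency_row v e = 0)"
        by (simp add: v_def)
      then have "\<forall>e. v e = 0"
        by (rule spec[OF kernel, THEN mp])
      then have v0: "v e = 0" for e by blast
      have "g c = g (cs ! 0)" if "c \<in> corners B" for c
        using that
      proof (cases rule: corner_cases)
        case (entry k)
        then show ?thesis using labelling_entry[OF g] v0 by simp
      next
        case (exit k)
        then show ?thesis using labelling_entry[OF g, of k] v0 jump entry_corner by simp
      qed
      then show "\<forall>c\<in>corners B. \<forall>d\<in>corners B. g c = g d" by metis
    qed
  qed
  finally show ?thesis .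
qed

end

section \<open>Boundary components of bouquets and partial duals\<close>

lemma boundary_components_partial_dual:
  shows "boundary_components (partial_dual G T) X = boundary_components G (sym_diff X T)"
proof -
  have "(\<lambda>c. if edge_of (partial_dual G T) c \<in> X then side (partial_dual G T) c else seg (partial_dual G T) c)
      = (\<lambda>c. if edge_of G c \<in> sym_diff X T then side G c else seg G c)"
    by (auto simp: partial_dual_def fun_eq_iff)
  moreover have "corners (partial_dual G T) = corners G" "isolated (partial_dual G T) = isolated G"
      "varc (partial_dual G T) = varc G"
    by (simp_all add: partial_dual_def)
  ultimately show ?thesis
    by (simp only: boundary_components_def)
qed

lemma spanning_quasi_tree_sym_diff_iff:
  assumes "T \<subseteq> edges G" and "X \<subseteq> edges G"
  shows "spanning_quasi_tree G (sym_diff X T) \<longleftrightarrow> card (boundary_components (partial_dual G T) X) = 1"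
proof -
  have "sym_diff X T \<subseteq> edges G" using assms by blast
  then show ?thesis by (simp only: spanning_quasi_tree_def boundary_components_partial_dual simp_thms)
qed

text \<open>An isolated vertex disc would be a vertex besides the one that carries the corners.\<close>

lemma card_boundary_components_bouquet:
  assumes B: "bouquet B" and nonempty: "corners B \<noteq> {}"
  shows "card (boundary_components B X)
    = card (curves (corners B) (varc B) (\<lambda>c. if edge_of B c \<in> X then side B c else seg B c))"
proof -
  have fin: "finite (curves (corners B) s t)" for s t
    using B unfolding bouquet_def ribbon_graph_def curves_def quotient_def by simp
  have finI: "finite (isolated B)" using B by (simp add: bouquet_def ribbon_graph_def)
  have "curves (corners B) (varc B) (seg B) \<noteq> {}"
    using nonempty by (auto simp: curves_def quotient_def)
  then have "card (curves (corners B) (varc B) (seg B)) \<ge> 1"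
    using fin[of "varc B" "seg B"] by (simp add: Suc_le_eq card_gt_0_iff)
  moreover have "card (curves (corners B) (varc B) (seg B)) + card (isolated B) = 1"
  proof -
    have "card (vertices B) = card (Inl ` curves (corners B) (varc B) (seg B) :: ('b set + 'c) set)
        + card (Inr ` isolated B :: ('b set + 'c) set)"
      unfolding vertices_def by (rule card_Un_disjoint) (use fin finI in auto)
    then show ?thesis using B by (simp add: bouquet_def card_image)
  qed
  ultimately have "card (isolated B) = 0" by linarith
  then have "isolated B = {}" using finI by simp
  then show ?thesis by (simp add: boundary_components_def card_image)
qed

section \<open>Spanning quasi-trees from the skew-adjacency matrix\<close>

text \<open>The value of an entry when its indeterminate is set to 1; below the diagonal this
  indeterminate is \<open>x\<^sub>j\<^sub>i\<close>, which the reduction map does not distinguish from \<open>x\<^sub>i\<^sub>j\<close>.\<close>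

definition skew_coeff :: "nat signed_seq \<Rightarrow> nat \<Rightarrow> nat \<Rightarrow> int" where
  "skew_coeff \<sigma> i j =
     (let upper = \<lambda>i j. if relative_order \<sigma> i j [(i, EndA), (j, EndA), (i, EndB), (j, EndB)] then 1
        else if relative_order \<sigma> i j [(i, EndA), (j, EndB), (i, EndB), (j, EndA)] then - 1 else 0
      in if i = j then (if opposite_signs \<sigma> i then 1 else 0)
         else if i < j then upper i j else - upper j i)"

lemma reduction_map_skew_entry:
  "reduction_map (skew_entry \<sigma> i j) = of_int (skew_coeff \<sigma> i j) * xset {i, j}"
proof (cases i j rule: linorder_cases)
  case greater
  then show ?thesis
    by (simp add: skew_entry_def upper_entry_def skew_coeff_def reduction_map_xvar
        reduction.hom_uminus insert_commute[of j i "{}"])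
qed (simp_all add: skew_entry_def upper_entry_def skew_coeff_def reduction_map_xvar reduction.hom_uminus)

lemma of_int_skew_coeff:
  "(of_int (skew_coeff \<sigma> i j) :: bit)
     = (if i = j then of_bool (opposite_signs \<sigma> i) else of_bool (interlaced \<sigma> i j))"
proof (cases i j rule: linorder_cases)
  case greater
  then show ?thesis
    unfolding interlaced_sym[of \<sigma> i j] by (simp add: skew_coeff_def interlaced_def)
qed (simp_all add: skew_coeff_def interlaced_def)

lemma reduction_map_det_skew_adjacency:
  "reduction_map (det (1\<^sub>m n + skew_adjacency n \<sigma>))
   = (\<Sum>S\<in>Pow {0..<n}.
        of_int (det (unit_rows_outside n S (\<lambda>i j. skew_coeff \<sigma> (Suc i) (Suc j)))) * xset (Suc ` S))"
proof -
  have "map_mat reduction_map (1\<^sub>m n + skew_adjacency n \<sigma>)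
      = 1\<^sub>m n + mat n n (\<lambda>(i, j). of_int (skew_coeff \<sigma> (Suc i) (Suc j)) * xset {Suc i, Suc j})"
    by (rule eq_matI)
      (simp_all add: skew_adjacency_def reduction.hom_add reduction_map_one reduction_map_skew_entry)
  from arg_cong[OF this, of det] show ?thesis
    unfolding reduction.hom_det det_one_plus_expansion .
qed

text \<open>For \<open>n = 0\<close> the bouquet is an isolated vertex without corners and the determinant is empty;
  otherwise both sides say that the kernel is trivial, with matrix index \<open>i\<close> standing for the
  edge \<open>Suc i\<close>.\<close>

lemma odd_det_iff_single_boundary:
  fixes B :: "(nat, 'f, 'v) ribbon"
  assumes rot: "signed_rotation B \<sigma>" and edges: "edges B = {1..n}" and S: "S \<subseteq> {0..<n}"
  shows "odd (det (unit_rows_outside n S (\<lambda>i j. skew_coeff \<sigma> (Suc i) (Suc j))))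
    \<longleftrightarrow> card (boundary_components B (Suc ` S)) = 1"
proof (cases "n = 0")
  case True
  then have "corners B = {}" using edges by (simp add: edges_def)
  then have "boundary_components B (Suc ` S) = vertices B"
    by (simp add: boundary_components_def vertices_def curves_def)
  moreover have "card (vertices B) = 1" using rot by (simp add: signed_rotation_def bouquet_def)
  ultimately show ?thesis using True by (simp add: unit_rows_outside_def det_def)
next
  case False
  let ?c = "\<lambda>i j. skew_coeff \<sigma> (Suc i) (Suc j)"
  have nonempty: "corners B \<noteq> {}" using edges False by (auto simp: edges_def)
  have bouquet: "bouquet B" using rot by (simp add: signed_rotation_def)
  obtain cs where cs: "length cs = length \<sigma>" "distinct cs" "set cs \<inter> seg B ` set cs = {}"
      "set cs \<union> seg B ` set cs = corners B"
      "\<forall>k<length cs. cs ! (Suc k mod length cs) = varc B (seg B (cs ! k)) \<and>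
         fst (\<sigma> ! k) = edge_of B (cs ! k)"
    using rot unfolding signed_rotation_def by (elim conjE exE) (rule that; assumption)
  have ends: "distinct (map (\<lambda>(i, l, s). (i, l)) \<sigma>)"
      "set (map (\<lambda>(i, l, s). (i, l)) \<sigma>) = edges B \<times> {EndA, EndB}"
    by (rule rot[unfolded signed_rotation_def, THEN conjunct2, THEN conjunct2, THEN conjunct1],
      rule rot[unfolded signed_rotation_def, THEN conjunct2, THEN conjunct2, THEN conjunct2, THEN conjunct1])
  interpret traversed_bouquet B \<sigma> cs
  proof (rule traversed_bouquet.intro)
    show "ribbon_graph B" using bouquet by (simp add: bouquet_def)
    show "cs ! (Suc k mod length cs) = varc B (seg B (cs ! k))" if "k < length cs" for k
      using cs(5) that by blast
    show "fst (\<sigma> ! k) = edge_of B (cs ! k)" if "k < length cs" for k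
      using cs(5) that by blast
  qed (fact cs ends)+
  have opposite: "opposite_signs \<sigma> i \<longleftrightarrow> \<not> orientable_loop B i" if "i \<in> edges B" for i
  proof -
    have sign: "\<exists>s. (i, l, s) \<in> set \<sigma>" for l
    proof -
      have "(i, l) \<in> set (map (\<lambda>(i, l, s). (i, l)) \<sigma>)"
        unfolding set_ends using that by (cases l) simp_all
      then show ?thesis by auto
    qed
    have "\<forall>s s'. (i, EndA, s) \<in> set \<sigma> \<and> (i, EndB, s') \<in> set \<sigma> \<longrightarrow> (s = s' \<longleftrightarrow> orientable_loop B i)"
      using rot unfolding signed_rotation_def by blast
    then show ?thesis
      using sign[of EndA] sign[of EndB] unfolding opposite_signs_def by blast
  qed
  have row: "(\<Sum>j=0..<n. of_int (?c i j) * v (Suc j)) = adjacency_row v (Suc i)"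
    if "i < n" for v :: "nat \<Rightarrow> bit" and i
  proof -
    have i: "Suc i \<in> edges B" using that edges by simp
    have "(\<Sum>j=0..<n. of_int (?c i j) * v (Suc j)) = (\<Sum>j\<in>edges B. of_int (skew_coeff \<sigma> (Suc i) j) * v j)"
      unfolding edges by (rule sum.reindex_bij_witness[of _ "\<lambda>j. j - 1" Suc]) auto
    also have "\<dots> = of_int (skew_coeff \<sigma> (Suc i) (Suc i)) * v (Suc i)
        + (\<Sum>j\<in>edges B - {Suc i}. of_int (skew_coeff \<sigma> (Suc i) j) * v j)"
      by (rule sum.remove[OF finite_edges i])
    also have "(\<Sum>j\<in>edges B - {Suc i}. of_int (skew_coeff \<sigma> (Suc i) j) * v j)
        = (\<Sum>j\<in>edges B - {Suc i}. of_bool (interlaced \<sigma> (Suc i) j) * v j)"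
      by (rule sum.cong) (auto simp: of_int_skew_coeff)
    finally show ?thesis
      using opposite[OF i] by (simp add: adjacency_row_def of_int_skew_coeff)
  qed
  have "odd (det (unit_rows_outside n S ?c)) \<longleftrightarrow>
      (\<forall>v :: nat \<Rightarrow> bit. (\<forall>i. i \<notin> S \<longrightarrow> v i = 0) \<and> (\<forall>i\<in>S. (\<Sum>j=0..<n. of_int (?c i j) * v j) = 0)
        \<longrightarrow> (\<forall>i. v i = 0))"
    by (rule odd_det_iff_trivial_kernel[OF S])
  also have "\<dots> \<longleftrightarrow> (\<forall>v. (\<forall>e. e \<notin> Suc ` S \<longrightarrow> v e = 0) \<and> (\<forall>e\<in>Suc ` S. adjacency_row v e = 0)
      \<longrightarrow> (\<forall>e. v e = 0))" (is "?L \<longleftrightarrow> ?R")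
  proof
    assume L: ?L
    show ?R
    proof (intro allI impI)
      fix v :: "nat \<Rightarrow> bit" and e
      assume v: "(\<forall>e. e \<notin> Suc ` S \<longrightarrow> v e = 0) \<and> (\<forall>e\<in>Suc ` S. adjacency_row v e = 0)"
      have "(\<Sum>j=0..<n. of_int (?c i j) * v (Suc j)) = 0" if "i \<in> S" for i
        using that S v row[of i v] by auto
      moreover have "v (Suc i) = 0" if "i \<notin> S" for i
        using that v by auto
      ultimately have "\<forall>i. v (Suc i) = 0"
        by (intro spec[OF L, of "\<lambda>i. v (Suc i)", THEN mp]) blast
      moreover have "v 0 = 0" using v by auto
      ultimately show "v e = 0" by (cases e) auto
    qed
  next
    assume R: ?R
    show ?L
    proof (intro allI impI)
      fix v :: "nat \<Rightarrow> bit" and i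
      assume v: "(\<forall>i. i \<notin> S \<longrightarrow> v i = 0) \<and> (\<forall>i\<in>S. (\<Sum>j=0..<n. of_int (?c i j) * v j) = 0)"
      define w where "w e = (case e of 0 \<Rightarrow> 0 | Suc j \<Rightarrow> v j)" for e
      have w_Suc: "w (Suc j) = v j" for j by (simp add: w_def)
      have "adjacency_row w (Suc j) = 0" if "j \<in> S" for j
      proof -
        have "j < n" using that S by auto
        then show ?thesis using row[of j w] that v by (simp add: w_Suc)
      qed
      moreover have "w e = 0" if "e \<notin> Suc ` S" for e
        using that v by (cases e) (auto simp: w_def)
      ultimately have "\<forall>e. w e = 0"
        by (intro spec[OF R, of w, THEN mp]) blast
      then show "v i = 0" using w_Suc by metis
    qed
  qed
  also have "\<dots> \<longleftrightarrow> card (boundary_components B (Suc ` S)) = 1"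
  proof -
    have "Suc ` S \<subseteq> edges B" using S edges by auto
    then show ?thesis
      using single_boundary_iff_trivial_kernel[OF _ nonempty]
      by (simp only: card_boundary_components_bouquet[OF bouquet nonempty])
  qed
  finally show ?thesis .
qed

theorem corollary4p8:
  fixes G :: "(nat, 'f, 'v) ribbon" and n :: nat and T :: "nat set"
    and \<sigma> :: "nat signed_seq"
  assumes "ribbon_graph G" and "connected_ribbon G" and "edges G = {1..n}"
    and "spanning_quasi_tree G T"
    and "signed_rotation (partial_dual G T) \<sigma>"
  shows "reduce_mod2 (reduction_map (Determinant.det (1\<^sub>m n + skew_adjacency n \<sigma>)))
           = (\<Sum>X | X \<subseteq> {1..n} \<and> spanning_quasi_tree G (sym_diff X T). xset X)
         \<and> int (num_spanning_quasi_trees G)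
           = eval_ones (reduce_mod2 (reduction_map (Determinant.det (1\<^sub>m n + skew_adjacency n \<sigma>))))"
proof -
  let ?d = "\<lambda>S. det (unit_rows_outside n S (\<lambda>i j. skew_coeff \<sigma> (Suc i) (Suc j)))"
  let ?\<X> = "{X. X \<subseteq> {1..n} \<and> spanning_quasi_tree G (sym_diff X T)}"
  have T: "T \<subseteq> {1..n}" using assms(3,4) by (simp add: spanning_quasi_tree_def)
  have odd_iff: "odd (?d S) \<longleftrightarrow> spanning_quasi_tree G (sym_diff (Suc ` S) T)"
    if "S \<subseteq> {0..<n}" for S
  proof -
    have "Suc ` S \<subseteq> edges G" using that assms(3) by auto
    then have "spanning_quasi_tree G (sym_diff (Suc ` S) T)
        \<longleftrightarrow> card (boundary_components (partial_dual G T) (Suc ` S)) = 1"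
      using T assms(3) by (intro spanning_quasi_tree_sym_diff_iff) auto
    moreover have "edges (partial_dual G T) = {1..n}"
      using assms(3) by (simp add: edges_partial_dual)
    ultimately show ?thesis
      using odd_det_iff_single_boundary[OF assms(5) _ that] by blast
  qed
  have image: "Suc ` {i. Suc i \<in> X} = X" if "X \<subseteq> {1..n}" for X
  proof (rule equalityI; rule subsetI)
    fix e assume "e \<in> X"
    then have "e \<noteq> 0" using that by auto
    then show "e \<in> Suc ` {i. Suc i \<in> X}" using \<open>e \<in> X\<close> by (cases e) auto
  qed auto
  have "reduce_mod2 (reduction_map (det (1\<^sub>m n + skew_adjacency n \<sigma>)))
      = (\<Sum>S | S \<in> Pow {0..<n} \<and> odd (?d S). xset (Suc ` S))"
    unfolding reduction_map_det_skew_adjacency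
    by (rule reduce_mod2_sum_xset) (auto simp: inj_on_def inj_image_eq_iff)
  also have "\<dots> = (\<Sum>X\<in>?\<X>. xset X)"
  proof (rule sum.reindex_bij_witness[of _ "\<lambda>X. {i. Suc i \<in> X}" "\<lambda>S. Suc ` S"])
    fix X assume X: "X \<in> ?\<X>"
    then have sub: "{i. Suc i \<in> X} \<subseteq> {0..<n}" by auto
    show "{i. Suc i \<in> X} \<in> {S. S \<in> Pow {0..<n} \<and> odd (?d S)}"
      using X sub image[of X] odd_iff[OF sub] by simp
    show "Suc ` {i. Suc i \<in> X} = X" using X image by blast
  next
    fix S assume S: "S \<in> {S. S \<in> Pow {0..<n} \<and> odd (?d S)}"
    then show "Suc ` S \<in> ?\<X>" using odd_iff[of S] by auto
  qed auto
  finally have poly: "reduce_mod2 (reduction_map (det (1\<^sub>m n + skew_adjacency n \<sigma>))) = (\<Sum>X\<in>?\<X>. xset X)" .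
  have "bij_betw (\<lambda>X. sym_diff X T) ?\<X> {X. spanning_quasi_tree G X}"
  proof (rule bij_betwI[where g = "\<lambda>X. sym_diff X T"])
    have involution: "sym_diff (sym_diff X T) T = X" for X by auto
    show "(\<lambda>X. sym_diff X T) \<in> {X. spanning_quasi_tree G X} \<rightarrow> ?\<X>"
      using T assms(3) by (auto simp: involution spanning_quasi_tree_def)
    show "sym_diff (sym_diff X T) T = X" for X by (rule involution)
    show "sym_diff (sym_diff X T) T = X" for X by (rule involution)
  qed auto
  then have "num_spanning_quasi_trees G = card ?\<X>"
    unfolding num_spanning_quasi_trees_def by (simp only: bij_betw_same_card)
  moreover have "eval_ones (\<Sum>X\<in>?\<X>. xset X) = int (card ?\<X>)"
    by (rule eval_ones_sum_xset) simp
  ultimately show ?thesis using poly by simp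
qed

end
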